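(* Let $\underline{\mathcal C}$ be a cofree $G$-$A$-coring, let $R=\bigoplus_{\alpha\in G}R_\alpha$ be its left dual graded ring and $R_e={}_A\mathrm{Hom}(\mathcal C_e,A)$ its part of degree $e$. Then $R$ is isomorphic, as a $G$-graded ring, to the group ring $R_e[G]=\bigoplus_{\alpha\in G}R_eu_\alpha$.
   Context: $G$ is a group with unit $e$, $A$ is a ring with unit. A $G$-$A$-coring (group coring) $\underline{\mathcal C}$ is a family $(\mathcal C_\alpha)_{\alpha\in G}$ of $A$-bimodules with $A$-bimodule maps $\Delta_{\alpha,\beta}:\mathcal C_{\alpha\beta}\to\mathcal C_\alpha\otimes_A\mathcal C_\beta$, written $\Delta_{\alpha,\beta}(c)=c_{(1,\alpha)}\otimes_Ac_{(2,\beta)}$, and $\varepsilon:\mathcal C_e\to A$ such that, for all $\alpha,\beta,\gamma\in G$, $(\Delta_{\alpha,\beta}\otimes_A\mathcal C_\gamma)\circ\Delta_{\alpha\beta,\gamma}=(\mathcal C_\alpha\otimes_A\Delta_{\beta,\gamma})\circ\Delta_{\alpha,\beta\gamma}$ and $(\mathcal C_\alpha\otimes_A\varepsilon)\circ\Delta_{\alpha,e}=\mathcal C_\alpha=(\varepsilon\otimes_A\mathcal C_\alpha)\circ\Delta_{e,\alpha}$ (an object also denotes its identity map). Then $\mathcal C_e$ is an $A$-coring with comultiplication $\Delta_{e,e}(c)=c_{(1)}\otimes_Ac_{(2)}$. $\underline{\mathcal C}$ is called cofree if there exist $A$-bimodule isomorphisms $\gamma_\alpha:\mathcal C_e\to\mathcal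 C_\alpha$ ($\alpha\in G$) such that $\Delta_{\alpha,\beta}(\gamma_{\alpha\beta}(c))=\gamma_\alpha(c_{(1)})\otimes_A\gamma_\beta(c_{(2)})$ for all $c\in\mathcal C_e$. The left dual graded ring of $\underline{\mathcal C}$ is $R=\bigoplus_{\alpha\in G}R_\alpha$, $R_\alpha={}_A\mathrm{Hom}(\mathcal C_{\alpha^{-1}},A)$ (left $A$-linear maps), with multiplication $(f\#g)(c)=g(c_{(1,\beta^{-1})}f(c_{(2,\alpha^{-1})}))$ for $f\in R_\alpha$, $g\in R_\beta$, $c\in\mathcal C_{(\alpha\beta)^{-1}}$, and unit $\varepsilon\in R_e$. The group ring $R_e[G]$ has multiplication $(ru_\alpha)(su_\beta)=(r\#s)u_{\alpha\beta}$ and degree-$\alpha$ component $R_eu_\alpha$. *)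

theory Defs
  imports "HOL-Algebra.Free_Abelian_Groups" "HOL-Algebra.QuotRing" "HOL-Algebra.Module"
begin

section \<open>Bimodules over a ring\<close>

text \<open>
  Bimodules extend the library record for modules (whose field \<open>smult\<close> is the left action) by a right
  action. As for modules in \<open>HOL-Algebra\<close>, the inherited fields \<open>mult\<close> and \<open>one\<close> carry no meaning.
\<close>

record ('a, 'm) bimodule = "('a, 'm) module" +
  rsmult :: "['m, 'a] \<Rightarrow> 'm" (infixl \<open>\<odot>\<^sub>r\<index>\<close> 70)

locale bimodule = A?: ring A + M?: abelian_group M
  for A :: "('a, 'k) ring_scheme" (structure) and M :: "('a, 'm) bimodule" (structure) +
  assumes smult_closed: "\<lbrakk>a \<in> carrier A; x \<in> carrier M\<rbrakk> \<Longrightarrow> a \<odot>\<^bsub>M\<^esub> x \<in> carrier M"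
    and smult_l_distr: "\<lbrakk>a \<in> carrier A; b \<in> carrier A; x \<in> carrier M\<rbrakk>
      \<Longrightarrow> (a \<oplus>\<^bsub>A\<^esub> b) \<odot>\<^bsub>M\<^esub> x = a \<odot>\<^bsub>M\<^esub> x \<oplus>\<^bsub>M\<^esub> b \<odot>\<^bsub>M\<^esub> x"
    and smult_r_distr: "\<lbrakk>a \<in> carrier A; x \<in> carrier M; y \<in> carrier M\<rbrakk>
      \<Longrightarrow> a \<odot>\<^bsub>M\<^esub> (x \<oplus>\<^bsub>M\<^esub> y) = a \<odot>\<^bsub>M\<^esub> x \<oplus>\<^bsub>M\<^esub> a \<odot>\<^bsub>M\<^esub> y"
    and smult_assoc: "\<lbrakk>a \<in> carrier A; b \<in> carrier A; x \<in> carrier M\<rbrakk>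
      \<Longrightarrow> (a \<otimes>\<^bsub>A\<^esub> b) \<odot>\<^bsub>M\<^esub> x = a \<odot>\<^bsub>M\<^esub> (b \<odot>\<^bsub>M\<^esub> x)"
    and smult_one: "x \<in> carrier M \<Longrightarrow> \<one>\<^bsub>A\<^esub> \<odot>\<^bsub>M\<^esub> x = x"
    and rsmult_closed: "\<lbrakk>x \<in> carrier M; a \<in> carrier A\<rbrakk> \<Longrightarrow> x \<odot>\<^sub>r\<^bsub>M\<^esub> a \<in> carrier M"
    and rsmult_l_distr: "\<lbrakk>x \<in> carrier M; y \<in> carrier M; a \<in> carrier A\<rbrakk>
      \<Longrightarrow> (x \<oplus>\<^bsub>M\<^esub> y) \<odot>\<^sub>r\<^bsub>M\<^esub> a = x \<odot>\<^sub>r\<^bsub>M\<^esub> a \<oplus>\<^bsub>M\<^esub> y \<odot>\<^sub>r\<^bsub>M\<^esub> a"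
    and rsmult_r_distr: "\<lbrakk>x \<in> carrier M; a \<in> carrier A; b \<in> carrier A\<rbrakk>
      \<Longrightarrow> x \<odot>\<^sub>r\<^bsub>M\<^esub> (a \<oplus>\<^bsub>A\<^esub> b) = x \<odot>\<^sub>r\<^bsub>M\<^esub> a \<oplus>\<^bsub>M\<^esub> x \<odot>\<^sub>r\<^bsub>M\<^esub> b"
    and rsmult_assoc: "\<lbrakk>x \<in> carrier M; a \<in> carrier A; b \<in> carrier A\<rbrakk>
      \<Longrightarrow> x \<odot>\<^sub>r\<^bsub>M\<^esub> (a \<otimes>\<^bsub>A\<^esub> b) = (x \<odot>\<^sub>r\<^bsub>M\<^esub> a) \<odot>\<^sub>r\<^bsub>M\<^esub> b"
    and rsmult_one: "x \<in> carrier M \<Longrightarrow> x \<odot>\<^sub>r\<^bsub>M\<^esub> \<one>\<^bsub>A\<^esub> = x"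
    and smult_rsmult: "\<lbrakk>a \<in> carrier A; x \<in> carrier M; b \<in> carrier A\<rbrakk>
      \<Longrightarrow> (a \<odot>\<^bsub>M\<^esub> x) \<odot>\<^sub>r\<^bsub>M\<^esub> b = a \<odot>\<^bsub>M\<^esub> (x \<odot>\<^sub>r\<^bsub>M\<^esub> b)"

definition regular_bimodule :: "('a, 'k) ring_scheme \<Rightarrow> ('a, 'a) bimodule" where
  "regular_bimodule A =
     \<lparr>carrier = carrier A, monoid.mult = monoid.mult A, one = monoid.one A, ring.zero = ring.zero A, add = ring.add A,
      smult = monoid.mult A, rsmult = monoid.mult A\<rparr>"

definition left_linear_maps ::
  "('a, 'k) ring_scheme \<Rightarrow> ('a, 'm) bimodule \<Rightarrow> ('a, 'n) bimodule \<Rightarrow> ('m \<Rightarrow> 'n) set" where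
  "left_linear_maps A M N =
     {f \<in> carrier M \<rightarrow> carrier N.
        (\<forall>x\<in>carrier M. \<forall>y\<in>carrier M. f (x \<oplus>\<^bsub>M\<^esub> y) = f x \<oplus>\<^bsub>N\<^esub> f y) \<and>
        (\<forall>a\<in>carrier A. \<forall>x\<in>carrier M. f (a \<odot>\<^bsub>M\<^esub> x) = a \<odot>\<^bsub>N\<^esub> f x)}"

definition bimodule_maps ::
  "('a, 'k) ring_scheme \<Rightarrow> ('a, 'm) bimodule \<Rightarrow> ('a, 'n) bimodule \<Rightarrow> ('m \<Rightarrow> 'n) set" where
  "bimodule_maps A M N =
     {f \<in> left_linear_maps A M N.
        \<forall>x\<in>carrier M. \<forall>a\<in>carrier A. f (x \<odot>\<^sub>r\<^bsub>M\<^esub> a) = f x \<odot>\<^sub>r\<^bsub>N\<^esub> a}"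

definition bimodule_isos ::
  "('a, 'k) ring_scheme \<Rightarrow> ('a, 'm) bimodule \<Rightarrow> ('a, 'n) bimodule \<Rightarrow> ('m \<Rightarrow> 'n) set" where
  "bimodule_isos A M N = {f \<in> bimodule_maps A M N. bij_betw f (carrier M) (carrier N)}"


section \<open>Tensor products over a ring\<close>

text \<open>
  The tensor product of \<open>M\<close> and \<open>N\<close> over \<open>A\<close> is the free abelian group on
  \<open>carrier M \<times> carrier N\<close> modulo the subgroup generated by the biadditivity and balancing relations.
  Its elements are cosets, that is, sets of formal integer combinations of pairs.
\<close>

type_synonym ('m, 'n) tensor = "(('m \<times> 'n) \<Rightarrow>\<^sub>0 int) set"

definition tensor_relations ::
  "('a, 'k) ring_scheme \<Rightarrow> ('a, 'm) bimodule \<Rightarrow> ('a, 'n) bimodule \<Rightarrow> (('m \<times> 'n) \<Rightarrow>\<^sub>0 int) set" where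
  "tensor_relations A M N =
     {frag_of (x \<oplus>\<^bsub>M\<^esub> x', y) - frag_of (x, y) - frag_of (x', y) | x x' y.
        x \<in> carrier M \<and> x' \<in> carrier M \<and> y \<in> carrier N} \<union>
     {frag_of (x, y \<oplus>\<^bsub>N\<^esub> y') - frag_of (x, y) - frag_of (x, y') | x y y'.
        x \<in> carrier M \<and> y \<in> carrier N \<and> y' \<in> carrier N} \<union>
     {frag_of (x \<odot>\<^sub>r\<^bsub>M\<^esub> a, y) - frag_of (x, a \<odot>\<^bsub>N\<^esub> y) | x a y.
        x \<in> carrier M \<and> a \<in> carrier A \<and> y \<in> carrier N}"

definition tensor_null ::
  "('a, 'k) ring_scheme \<Rightarrow> ('a, 'm) bimodule \<Rightarrow> ('a, 'n) bimodule \<Rightarrow> (('m \<times> 'n) \<Rightarrow>\<^sub>0 int) set" where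
  "tensor_null A M N =
     generate (free_Abelian_group (carrier M \<times> carrier N)) (tensor_relations A M N)"

definition tensor_group ::
  "('a, 'k) ring_scheme \<Rightarrow> ('a, 'm) bimodule \<Rightarrow> ('a, 'n) bimodule \<Rightarrow> ('m, 'n) tensor ring" where
  "tensor_group A M N =
     (let Q = free_Abelian_group (carrier M \<times> carrier N) Mod tensor_null A M N
      in \<lparr>carrier = carrier Q, monoid.mult = undefined, one = undefined,
          ring.zero = monoid.one Q, add = monoid.mult Q\<rparr>)"

definition pure_tensor ::
  "('a, 'k) ring_scheme \<Rightarrow> ('a, 'm) bimodule \<Rightarrow> ('a, 'n) bimodule \<Rightarrow> 'm \<Rightarrow> 'n \<Rightarrow> ('m, 'n) tensor" where
  "pure_tensor A M N x y =
     tensor_null A M N #>\<^bsub>free_Abelian_group (carrier M \<times> carrier N)\<^esub> frag_of (x, y)"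

text \<open>
  The additive map induced by a biadditive balanced map \<open>\<phi>\<close> with values in the additive group of \<open>B\<close>:
  it sends the class of \<open>\<Sum>\<^sub>i k\<^sub>i (x\<^sub>i, y\<^sub>i)\<close> to \<open>\<Sum>\<^sub>i k\<^sub>i \<phi> x\<^sub>i y\<^sub>i\<close>. For such \<open>\<phi>\<close> all representatives of a
  class have the same value, so that \<open>the_elem\<close> is applied to a singleton.
\<close>

definition tensor_lift ::
  "('b, 'l) ring_scheme \<Rightarrow> ('m \<Rightarrow> 'n \<Rightarrow> 'b) \<Rightarrow> ('m, 'n) tensor \<Rightarrow> 'b" where
  "tensor_lift B \<phi> X =
     the_elem ((\<lambda>t. \<Oplus>\<^bsub>B\<^esub>p\<in>Poly_Mapping.keys t.
                  add_pow B (Poly_Mapping.lookup t p) (\<phi> (fst p) (snd p))) ` X)"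

definition tensor_bimodule ::
  "('a, 'k) ring_scheme \<Rightarrow> ('a, 'm) bimodule \<Rightarrow> ('a, 'n) bimodule
     \<Rightarrow> ('a, ('m, 'n) tensor) bimodule" where
  "tensor_bimodule A M N =
     (let T = tensor_group A M N
      in \<lparr>carrier = carrier T, monoid.mult = undefined, one = undefined, ring.zero = ring.zero T, add = ring.add T,
          smult = (\<lambda>a. tensor_lift T (\<lambda>x y. pure_tensor A M N (a \<odot>\<^bsub>M\<^esub> x) y)),
          rsmult = (\<lambda>X a. tensor_lift T (\<lambda>x y. pure_tensor A M N x (y \<odot>\<^sub>r\<^bsub>N\<^esub> a)) X)\<rparr>)"

definition tensor_map ::
  "('a, 'k) ring_scheme \<Rightarrow> ('a, 'm') bimodule \<Rightarrow> ('a, 'n') bimodule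
     \<Rightarrow> ('m \<Rightarrow> 'm') \<Rightarrow> ('n \<Rightarrow> 'n') \<Rightarrow> ('m, 'n) tensor \<Rightarrow> ('m', 'n') tensor" where
  "tensor_map A M' N' f g =
     tensor_lift (tensor_bimodule A M' N') (\<lambda>x y. pure_tensor A M' N' (f x) (g y))"

text \<open>The canonical isomorphisms that are usually suppressed from the notation.\<close>

definition tensor_assoc ::
  "('a, 'k) ring_scheme \<Rightarrow> ('a, 'm) bimodule \<Rightarrow> ('a, 'n) bimodule \<Rightarrow> ('a, 'p) bimodule
     \<Rightarrow> (('m, 'n) tensor, 'p) tensor \<Rightarrow> ('m, ('n, 'p) tensor) tensor" where
  "tensor_assoc A M N P =
     (let T = tensor_bimodule A M (tensor_bimodule A N P)
      in tensor_lift T (\<lambda>t z. tensor_lift T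
           (\<lambda>x y. pure_tensor A M (tensor_bimodule A N P) x (pure_tensor A N P y z)) t))"

definition tensor_unit_right :: "('a, 'm) bimodule \<Rightarrow> ('m, 'a) tensor \<Rightarrow> 'm" where
  "tensor_unit_right M = tensor_lift M (\<lambda>x a. x \<odot>\<^sub>r\<^bsub>M\<^esub> a)"

definition tensor_unit_left :: "('a, 'm) bimodule \<Rightarrow> ('a, 'm) tensor \<Rightarrow> 'm" where
  "tensor_unit_left M = tensor_lift M (\<lambda>a x. a \<odot>\<^bsub>M\<^esub> x)"


section \<open>Group corings\<close>

locale group_coring = G?: group G + A?: ring A
  for G :: "('g, 'h) monoid_scheme" (structure)
    and A :: "('a, 'k) ring_scheme" (structure) +
  fixes C :: "'g \<Rightarrow> ('a, 'c) bimodule"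
    and \<Delta> :: "'g \<Rightarrow> 'g \<Rightarrow> 'c \<Rightarrow> ('c, 'c) tensor"
    and \<epsilon> :: "'c \<Rightarrow> 'a"
  assumes bimodule: "\<alpha> \<in> carrier G \<Longrightarrow> bimodule A (C \<alpha>)"
    and comult: "\<lbrakk>\<alpha> \<in> carrier G; \<beta> \<in> carrier G\<rbrakk> \<Longrightarrow>
      \<Delta> \<alpha> \<beta> \<in> bimodule_maps A (C (\<alpha> \<otimes>\<^bsub>G\<^esub> \<beta>)) (tensor_bimodule A (C \<alpha>) (C \<beta>))"
    and counit: "\<epsilon> \<in> bimodule_maps A (C \<one>\<^bsub>G\<^esub>) (regular_bimodule A)"
    and coassoc: "\<lbrakk>\<alpha> \<in> carrier G; \<beta> \<in> carrier G; \<gamma> \<in> carrier G;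
        c \<in> carrier (C (\<alpha> \<otimes>\<^bsub>G\<^esub> \<beta> \<otimes>\<^bsub>G\<^esub> \<gamma>))\<rbrakk> \<Longrightarrow>
      tensor_assoc A (C \<alpha>) (C \<beta>) (C \<gamma>)
        (tensor_map A (tensor_bimodule A (C \<alpha>) (C \<beta>)) (C \<gamma>) (\<Delta> \<alpha> \<beta>) id
          (\<Delta> (\<alpha> \<otimes>\<^bsub>G\<^esub> \<beta>) \<gamma> c)) =
      tensor_map A (C \<alpha>) (tensor_bimodule A (C \<beta>) (C \<gamma>)) id (\<Delta> \<beta> \<gamma>)
        (\<Delta> \<alpha> (\<beta> \<otimes>\<^bsub>G\<^esub> \<gamma>) c)"
    and counit_right: "\<lbrakk>\<alpha> \<in> carrier G; c \<in> carrier (C \<alpha>)\<rbrakk> \<Longrightarrow>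
      tensor_unit_right (C \<alpha>)
        (tensor_map A (C \<alpha>) (regular_bimodule A) id \<epsilon> (\<Delta> \<alpha> \<one>\<^bsub>G\<^esub> c)) = c"
    and counit_left: "\<lbrakk>\<alpha> \<in> carrier G; c \<in> carrier (C \<alpha>)\<rbrakk> \<Longrightarrow>
      tensor_unit_left (C \<alpha>)
        (tensor_map A (regular_bimodule A) (C \<alpha>) \<epsilon> id (\<Delta> \<one>\<^bsub>G\<^esub> \<alpha> c)) = c"

definition cofree ::
  "('g, 'h) monoid_scheme \<Rightarrow> ('a, 'k) ring_scheme \<Rightarrow> ('g \<Rightarrow> ('a, 'c) bimodule)
     \<Rightarrow> ('g \<Rightarrow> 'g \<Rightarrow> 'c \<Rightarrow> ('c, 'c) tensor) \<Rightarrow> bool" where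
  "cofree G A C \<Delta> \<longleftrightarrow>
     (\<exists>\<gamma> :: 'g \<Rightarrow> 'c \<Rightarrow> 'c.
        (\<forall>\<alpha>\<in>carrier G. \<gamma> \<alpha> \<in> bimodule_isos A (C \<one>\<^bsub>G\<^esub>) (C \<alpha>)) \<and>
        (\<forall>\<alpha>\<in>carrier G. \<forall>\<beta>\<in>carrier G. \<forall>c\<in>carrier (C \<one>\<^bsub>G\<^esub>).
           \<Delta> \<alpha> \<beta> (\<gamma> (\<alpha> \<otimes>\<^bsub>G\<^esub> \<beta>) c) =
           tensor_map A (C \<alpha>) (C \<beta>) (\<gamma> \<alpha>) (\<gamma> \<beta>) (\<Delta> \<one>\<^bsub>G\<^esub> \<one>\<^bsub>G\<^esub> c)))"


section \<open>Graded rings\<close>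

text \<open>
  The graded ring with additive group \<open>\<Oplus>\<^sub>\<alpha> R \<alpha>\<close> whose multiplication is the biadditive extension of
  maps \<open>mul \<alpha> \<beta>\<close> from \<open>R \<alpha> \<times> R \<beta>\<close> to \<open>R (\<alpha>\<beta>)\<close> and whose unit is \<open>u\<close> in degree \<open>\<one>\<close>. Elements are the
  finitely supported families of the library's \<open>sum_group\<close>. Only the additive structure of the
  records \<open>R \<alpha>\<close> is used.
\<close>

definition graded_sum_ring ::
  "('g, 'h) monoid_scheme \<Rightarrow> ('g \<Rightarrow> 'r ring) \<Rightarrow> ('g \<Rightarrow> 'g \<Rightarrow> 'r \<Rightarrow> 'r \<Rightarrow> 'r) \<Rightarrow> 'r
     \<Rightarrow> ('g \<Rightarrow> 'r) ring" where
  "graded_sum_ring G R mul u =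
     (let S = sum_group (carrier G) (\<lambda>\<alpha>. add_monoid (R \<alpha>));
          supp = (\<lambda>F. {\<alpha> \<in> carrier G. F \<alpha> \<noteq> \<zero>\<^bsub>R \<alpha>\<^esub>})
      in \<lparr>carrier = carrier S,
          monoid.mult = (\<lambda>F H. \<lambda>\<gamma>\<in>carrier G.
            finsum (R \<gamma>) (\<lambda>(\<alpha>, \<beta>). mul \<alpha> \<beta> (F \<alpha>) (H \<beta>))
              {(\<alpha>, \<beta>). \<alpha> \<in> supp F \<and> \<beta> \<in> supp H \<and> \<alpha> \<otimes>\<^bsub>G\<^esub> \<beta> = \<gamma>}),
          one = (\<lambda>\<alpha>\<in>carrier G. if \<alpha> = \<one>\<^bsub>G\<^esub> then u else \<zero>\<^bsub>R \<alpha>\<^esub>),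
          ring.zero = monoid.one S,
          add = monoid.mult S\<rparr>)"

definition homogeneous_part :: "('g, 'h) monoid_scheme \<Rightarrow> ('g \<Rightarrow> 'r) ring \<Rightarrow> 'g \<Rightarrow> ('g \<Rightarrow> 'r) set" where
  "homogeneous_part G R \<alpha> = {F \<in> carrier R. \<forall>\<beta>\<in>carrier G - {\<alpha>}. F \<beta> = \<zero>\<^bsub>R\<^esub> \<beta>}"

definition graded_ring_isos ::
  "('g, 'h) monoid_scheme \<Rightarrow> ('r, 'k) ring_scheme \<Rightarrow> ('g \<Rightarrow> 'r set)
     \<Rightarrow> ('s, 'l) ring_scheme \<Rightarrow> ('g \<Rightarrow> 's set) \<Rightarrow> ('r \<Rightarrow> 's) set" where
  "graded_ring_isos G R R_deg S S_deg =
     {h \<in> ring_iso R S. \<forall>\<alpha>\<in>carrier G. h ` R_deg \<alpha> = S_deg \<alpha>}"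

text \<open>The family with value \<open>r\<close> at \<open>\<alpha>\<close> and zero elsewhere is the element written \<open>r u\<^sub>\<alpha>\<close>.\<close>

definition group_ring :: "('g, 'h) monoid_scheme \<Rightarrow> 'r ring \<Rightarrow> ('g \<Rightarrow> 'r) ring" where
  "group_ring G S = graded_sum_ring G (\<lambda>_. S) (\<lambda>_ _. monoid.mult S) \<one>\<^bsub>S\<^esub>"


section \<open>The left dual graded ring of a group coring\<close>

text \<open>
  Left linear maps are represented by functions that are \<open>undefined\<close> outside the carrier, so that equal
  maps are equal functions.
\<close>

definition left_dual :: "('a, 'k) ring_scheme \<Rightarrow> ('a, 'm) bimodule \<Rightarrow> ('m \<Rightarrow> 'a) ring" where
  "left_dual A M =
     \<lparr>carrier = left_linear_maps A M (regular_bimodule A) \<inter> extensional (carrier M),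
      monoid.mult = undefined, one = undefined,
      ring.zero = (\<lambda>c\<in>carrier M. \<zero>\<^bsub>A\<^esub>),
      add = (\<lambda>f g. \<lambda>c\<in>carrier M. f c \<oplus>\<^bsub>A\<^esub> g c)\<rparr>"

definition dual_mult ::
  "('g, 'h) monoid_scheme \<Rightarrow> ('a, 'k) ring_scheme \<Rightarrow> ('g \<Rightarrow> ('a, 'c) bimodule)
     \<Rightarrow> ('g \<Rightarrow> 'g \<Rightarrow> 'c \<Rightarrow> ('c, 'c) tensor)
     \<Rightarrow> 'g \<Rightarrow> 'g \<Rightarrow> ('c \<Rightarrow> 'a) \<Rightarrow> ('c \<Rightarrow> 'a) \<Rightarrow> ('c \<Rightarrow> 'a)" where
  "dual_mult G A C \<Delta> \<alpha> \<beta> f g =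
     (\<lambda>c\<in>carrier (C (inv\<^bsub>G\<^esub> (\<alpha> \<otimes>\<^bsub>G\<^esub> \<beta>))).
        tensor_lift A (\<lambda>x y. g (x \<odot>\<^sub>r\<^bsub>C (inv\<^bsub>G\<^esub> \<beta>)\<^esub> f y)) (\<Delta> (inv\<^bsub>G\<^esub> \<beta>) (inv\<^bsub>G\<^esub> \<alpha>) c))"

definition left_dual_graded_ring ::
  "('g, 'h) monoid_scheme \<Rightarrow> ('a, 'k) ring_scheme \<Rightarrow> ('g \<Rightarrow> ('a, 'c) bimodule)
     \<Rightarrow> ('g \<Rightarrow> 'g \<Rightarrow> 'c \<Rightarrow> ('c, 'c) tensor) \<Rightarrow> ('c \<Rightarrow> 'a) \<Rightarrow> ('g \<Rightarrow> 'c \<Rightarrow> 'a) ring" where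
  "left_dual_graded_ring G A C \<Delta> \<epsilon> =
     graded_sum_ring G (\<lambda>\<alpha>. left_dual A (C (inv\<^bsub>G\<^esub> \<alpha>))) (dual_mult G A C \<Delta>)
       (restrict \<epsilon> (carrier (C \<one>\<^bsub>G\<^esub>)))"

definition left_dual_unit_part ::
  "('g, 'h) monoid_scheme \<Rightarrow> ('a, 'k) ring_scheme \<Rightarrow> ('g \<Rightarrow> ('a, 'c) bimodule)
     \<Rightarrow> ('g \<Rightarrow> 'g \<Rightarrow> 'c \<Rightarrow> ('c, 'c) tensor) \<Rightarrow> ('c \<Rightarrow> 'a) \<Rightarrow> ('c \<Rightarrow> 'a) ring" where
  "left_dual_unit_part G A C \<Delta> \<epsilon> =
     (left_dual A (C \<one>\<^bsub>G\<^esub>))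
       \<lparr>monoid.mult := dual_mult G A C \<Delta> \<one>\<^bsub>G\<^esub> \<one>\<^bsub>G\<^esub>, one := restrict \<epsilon> (carrier (C \<one>\<^bsub>G\<^esub>))\<rparr>"

end

theory Submission
  imports Defs
begin

text \<open>
  In a cofree coring every \<open>C \<alpha>\<close> is a copy of \<open>C \<one>\<close>, and the copies are compatible with all comultiplications.
  Composing a left linear form on \<open>C (inv \<alpha>)\<close> with the isomorphism \<open>C \<one> \<rightarrow> C (inv \<alpha>)\<close> gives a left linear form on
  \<open>C \<one>\<close>, and doing this in each degree is the isomorphism from the left dual graded ring to the group ring.

  Three points need proof. Multiplicativity on homogeneous elements (\<open>pullback_dual_mult\<close>): the product of \<open>f\<close> and
  \<open>g\<close> is the lift of \<open>x \<otimes> y \<mapsto> g (x \<cdot> f y)\<close> applied to the comultiplication, and by cofreeness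
  the comultiplication of a transported element is the transport of its comultiplication in \<open>C \<one>\<close>;
  since the isomorphisms commute with both actions, the two lifts agree on pure tensors, hence everywhere
  (\<open>convolution_pullback\<close>). Preservation of the unit: the isomorphisms can be chosen so that the one
  in degree \<open>\<one>\<close> is the identity (\<open>cofree_normalized\<close>), and then the counit is sent to itself. Passage from
  homogeneous elements to the direct sums: this is the general statement \<open>graded_sum_ring_isoI\<close>.

  The tensor products are quotients of free abelian groups, so all this rests on their universal property,
  which is established first: \<open>tensor_lift_hom\<close> and \<open>tensor_lift_pure\<close> for existence, \<open>tensor_hom_eqI\<close> for
  uniqueness.
\<close>

section \<open>The universal property of the tensor product\<close>

lemma abelian_group_from_comm_group:
  assumes "comm_group Q" and "carrier R = carrier Q" "add R = monoid.mult Q" "ring.zero R = monoid.one Q"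
  shows "abelian_group R"
proof -
  interpret Q: comm_group Q by fact
  show ?thesis
  proof (rule abelian_groupI)
    show "\<exists>y\<in>carrier R. y \<oplus>\<^bsub>R\<^esub> x = \<zero>\<^bsub>R\<^esub>" if "x \<in> carrier R" for x
      using that Q.l_inv_ex [of x] by (simp add: assms(2-))
  qed (simp_all add: assms(2-) Q.m_assoc, rule Q.m_comm)
qed

lemma hom_cong_carrier:
  assumes "f \<in> hom G H" and "group G" and "\<And>x. x \<in> carrier G \<Longrightarrow> g x = f x"
  shows "g \<in> hom G H"
  using assms by (auto simp: hom_def Pi_iff group.is_monoid monoid.m_closed)

locale bimodule_pair = M: bimodule A M + N: bimodule A N
  for A :: "('a, 'k) ring_scheme" and M :: "('a, 'm) bimodule" and N :: "('a, 'n) bimodule"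
begin

definition balanced_map :: "('b, 'l) ring_scheme \<Rightarrow> ('m \<Rightarrow> 'n \<Rightarrow> 'b) \<Rightarrow> bool" where
  "balanced_map B \<phi> \<longleftrightarrow>
     (\<forall>x\<in>carrier M. \<forall>y\<in>carrier N. \<phi> x y \<in> carrier B) \<and>
     (\<forall>x\<in>carrier M. \<forall>x'\<in>carrier M. \<forall>y\<in>carrier N. \<phi> (x \<oplus>\<^bsub>M\<^esub> x') y = \<phi> x y \<oplus>\<^bsub>B\<^esub> \<phi> x' y) \<and>
     (\<forall>x\<in>carrier M. \<forall>y\<in>carrier N. \<forall>y'\<in>carrier N. \<phi> x (y \<oplus>\<^bsub>N\<^esub> y') = \<phi> x y \<oplus>\<^bsub>B\<^esub> \<phi> x y') \<and>
     (\<forall>x\<in>carrier M. \<forall>a\<in>carrier A. \<forall>y\<in>carrier N. \<phi> (x \<odot>\<^sub>r\<^bsub>M\<^esub> a) y = \<phi> x (a \<odot>\<^bsub>N\<^esub> y))"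

abbreviation F where "F \<equiv> free_Abelian_group (carrier M \<times> carrier N)"
abbreviation K where "K \<equiv> tensor_null A M N"
abbreviation T where "T \<equiv> tensor_bimodule A M N"

lemma balanced_mapI:
  assumes "\<And>x y. \<lbrakk>x \<in> carrier M; y \<in> carrier N\<rbrakk> \<Longrightarrow> \<phi> x y \<in> carrier B"
    and "\<And>x x' y. \<lbrakk>x \<in> carrier M; x' \<in> carrier M; y \<in> carrier N\<rbrakk> \<Longrightarrow>
      \<phi> (x \<oplus>\<^bsub>M\<^esub> x') y = \<phi> x y \<oplus>\<^bsub>B\<^esub> \<phi> x' y"
    and "\<And>x y y'. \<lbrakk>x \<in> carrier M; y \<in> carrier N; y' \<in> carrier N\<rbrakk> \<Longrightarrow>
      \<phi> x (y \<oplus>\<^bsub>N\<^esub> y') = \<phi> x y \<oplus>\<^bsub>B\<^esub> \<phi> x y'"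
    and "\<And>x a y. \<lbrakk>x \<in> carrier M; a \<in> carrier A; y \<in> carrier N\<rbrakk> \<Longrightarrow>
      \<phi> (x \<odot>\<^sub>r\<^bsub>M\<^esub> a) y = \<phi> x (a \<odot>\<^bsub>N\<^esub> y)"
  shows "balanced_map B \<phi>"
  using assms by (simp add: balanced_map_def)

lemma balanced_mapD:
  assumes "balanced_map B \<phi>"
  shows "\<lbrakk>x \<in> carrier M; y \<in> carrier N\<rbrakk> \<Longrightarrow> \<phi> x y \<in> carrier B"
    and "\<lbrakk>x \<in> carrier M; x' \<in> carrier M; y \<in> carrier N\<rbrakk> \<Longrightarrow>
      \<phi> (x \<oplus>\<^bsub>M\<^esub> x') y = \<phi> x y \<oplus>\<^bsub>B\<^esub> \<phi> x' y"
    and "\<lbrakk>x \<in> carrier M; y \<in> carrier N; y' \<in> carrier N\<rbrakk> \<Longrightarrow>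
      \<phi> x (y \<oplus>\<^bsub>N\<^esub> y') = \<phi> x y \<oplus>\<^bsub>B\<^esub> \<phi> x y'"
    and "\<lbrakk>x \<in> carrier M; a \<in> carrier A; y \<in> carrier N\<rbrakk> \<Longrightarrow>
      \<phi> (x \<odot>\<^sub>r\<^bsub>M\<^esub> a) y = \<phi> x (a \<odot>\<^bsub>N\<^esub> y)"
  using assms by (simp_all add: balanced_map_def)

lemma tensor_relations_subset: "tensor_relations A M N \<subseteq> carrier F"
  unfolding tensor_relations_def
  by (auto dest!: subsetD [OF keys_diff] simp: keys_frag_of
      M.rsmult_closed N.smult_closed)

lemma tensor_null_subgroup: "subgroup K F"
  unfolding tensor_null_def
  by (rule group.generate_is_subgroup) (use tensor_relations_subset in auto)

lemma tensor_null_normal: "K \<lhd> F"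
  using comm_group.normal_iff_subgroup [OF abelian_free_Abelian_group] tensor_null_subgroup
  by blast

lemma tensor_simps:
  "carrier T = carrier (F Mod K)" "add T = monoid.mult (F Mod K)" "ring.zero T = monoid.one (F Mod K)"
  by (simp_all add: tensor_bimodule_def tensor_group_def Let_def)

lemma carrier_tensor: "carrier T = (\<lambda>t. K #>\<^bsub>F\<^esub> t) ` carrier F"
  by (simp add: tensor_simps carrier_FactGroup)

lemma add_coset:
  assumes "t \<in> carrier F" "u \<in> carrier F"
  shows "(K #>\<^bsub>F\<^esub> t) \<oplus>\<^bsub>T\<^esub> (K #>\<^bsub>F\<^esub> u) = K #>\<^bsub>F\<^esub> (t + u)"
  using normal.rcos_sum [OF tensor_null_normal assms] by (simp add: tensor_simps)

lemma comm_group_tensor: "comm_group (F Mod K)"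
  by (simp add: comm_group.abelian_FactGroup abelian_free_Abelian_group tensor_null_subgroup)

lemma abelian_group_tensor: "abelian_group T"
  by (rule abelian_group_from_comm_group [OF comm_group_tensor]) (simp_all only: tensor_simps)

lemma abelian_group_tensor_group: "abelian_group (tensor_group A M N)"
  by (rule abelian_group_from_comm_group [OF comm_group_tensor])
    (simp_all add: tensor_group_def Let_def)

lemma coset_hom: "(\<lambda>t. K #>\<^bsub>F\<^esub> t) \<in> hom F (add_monoid T)"
  by (rule homI) (simp_all add: carrier_tensor add_coset)

lemma pure_tensor_in: "\<lbrakk>x \<in> carrier M; y \<in> carrier N\<rbrakk> \<Longrightarrow> pure_tensor A M N x y \<in> carrier T"
  by (simp add: pure_tensor_def carrier_tensor keys_frag_of)

end

text \<open>
  The formula inside \<open>tensor_lift\<close> is the universal extension of \<open>f\<close> to the free abelian group. Additivity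
  is not termwise, since the keys of a sum depend on cancellation; both sums are therefore
  taken over the union of the two sets of keys, where the additional terms vanish.
\<close>

lemma frag_sum_hom:
  fixes f :: "'s \<Rightarrow> 'b"
  assumes "abelian_group B" and f: "\<And>p. p \<in> S \<Longrightarrow> f p \<in> carrier B"
  shows "(\<lambda>t. \<Oplus>\<^bsub>B\<^esub>p\<in>Poly_Mapping.keys t. add_pow B (Poly_Mapping.lookup t p) (f p))
    \<in> hom (free_Abelian_group S) (add_monoid B)"
    (is "?h \<in> _")
proof (rule homI)
  interpret B: abelian_group B by fact
  have closed: "(\<lambda>p. add_pow B (Poly_Mapping.lookup t p) (f p)) \<in> S \<rightarrow> carrier B" for t :: "'s \<Rightarrow>\<^sub>0 int"
    using f by (auto intro!: B.add.int_pow_closed)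
  show "?h t \<in> carrier (add_monoid B)" if "t \<in> carrier (free_Abelian_group S)" for t
    using that closed by (auto intro!: B.finsum_closed)
  have zero: "add_pow B (0::int) x = \<zero>\<^bsub>B\<^esub>" for x
    by (simp add: add_pow_def)
  have widen: "?h t = (\<Oplus>\<^bsub>B\<^esub>p\<in>U. add_pow B (Poly_Mapping.lookup t p) (f p))"
    if "Poly_Mapping.keys t \<subseteq> U" "U \<subseteq> S" "finite U" for t U
    using that closed
    by (intro B.add.finprod_mono_neutral_cong_left)
      (auto simp: in_keys_iff zero)
  fix t u
  assume "t \<in> carrier (free_Abelian_group S)" "u \<in> carrier (free_Abelian_group S)"
  then have tu: "Poly_Mapping.keys t \<subseteq> S" "Poly_Mapping.keys u \<subseteq> S" by auto
  let ?U = "Poly_Mapping.keys t \<union> Poly_Mapping.keys u"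
  have "?h (t + u) = (\<Oplus>\<^bsub>B\<^esub>p\<in>?U. add_pow B (Poly_Mapping.lookup (t + u) p) (f p))"
    using tu by (intro widen) (auto dest: subsetD [OF keys_add])
  also have "\<dots> = (\<Oplus>\<^bsub>B\<^esub>p\<in>?U. add_pow B (Poly_Mapping.lookup t p) (f p) \<oplus>\<^bsub>B\<^esub>
      add_pow B (Poly_Mapping.lookup u p) (f p))"
    using tu f
    by (intro B.finsum_cong') (auto simp: lookup_add B.add.int_pow_mult intro!: B.add.int_pow_closed)
  also have "\<dots> = ?h t \<oplus>\<^bsub>B\<^esub> ?h u"
    using tu f
    by (subst (1 2) widen [of _ ?U]) (auto intro!: B.finsum_addf B.add.int_pow_closed)
  finally show "?h (t \<otimes>\<^bsub>free_Abelian_group S\<^esub> u) = ?h t \<otimes>\<^bsub>add_monoid B\<^esub> ?h u"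
    by simp
qed

context bimodule_pair
begin

text \<open>
  This is the well-definedness of \<open>tensor_lift\<close>: a balanced map kills the three families of relations,
  hence the subgroup that they generate, so that its extension to formal sums is constant on cosets.
\<close>

lemma tensor_lift_coset:
  assumes "abelian_group B" and \<phi>: "balanced_map B \<phi>" and t: "t \<in> carrier F"
  shows "tensor_lift B \<phi> (K #>\<^bsub>F\<^esub> t) =
    (\<Oplus>\<^bsub>B\<^esub>p\<in>Poly_Mapping.keys t. add_pow B (Poly_Mapping.lookup t p) (\<phi> (fst p) (snd p)))"
    (is "_ = ?h t")
proof -
  interpret B: abelian_group B by fact
  interpret F: group F by simp
  have hom: "?h \<in> hom F (add_monoid B)"
    by (rule frag_sum_hom) (use assms in \<open>auto simp: balanced_map_def\<close>)
  interpret h: group_hom F "add_monoid B" ?h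
    by unfold_locales (fact hom)
  have h_of: "?h (frag_of (x, y)) = \<phi> x y" if "x \<in> carrier M" "y \<in> carrier N" for x y
    using balanced_mapD(1) [OF \<phi> that]
    by (simp add: keys_frag_of)
  have h_diff: "?h (r - s) = ?h r \<ominus>\<^bsub>B\<^esub> ?h s" if "r \<in> carrier F" "s \<in> carrier F" for r s
  proof -
    have "?h (r - s) = ?h (r \<otimes>\<^bsub>F\<^esub> inv\<^bsub>F\<^esub> s)"
      using that by simp
    also have "\<dots> = ?h r \<otimes>\<^bsub>add_monoid B\<^esub> inv\<^bsub>add_monoid B\<^esub> ?h s"
      using that by (simp only: h.hom_mult h.hom_inv F.inv_closed)
    finally show ?thesis
      by (simp add: a_minus_def a_inv_def)
  qed
  have "tensor_relations A M N \<subseteq> kernel F (add_monoid B) ?h"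
  proof
    fix r assume r: "r \<in> tensor_relations A M N"
    have sub: "frag_of p - frag_of q \<in> carrier F" if "p \<in> carrier M \<times> carrier N" "q \<in> carrier M \<times> carrier N" for p q
      using that by (auto dest!: subsetD [OF keys_diff] simp: keys_frag_of)
    have cancel: "u \<oplus>\<^bsub>B\<^esub> v \<ominus>\<^bsub>B\<^esub> u \<ominus>\<^bsub>B\<^esub> v = \<zero>\<^bsub>B\<^esub>" if "u \<in> carrier B" "v \<in> carrier B" for u v
      using that B.r_neg [of "u \<oplus>\<^bsub>B\<^esub> v"] by (simp add: a_minus_def B.minus_add B.a_assoc)
    have self: "u \<ominus>\<^bsub>B\<^esub> u = \<zero>\<^bsub>B\<^esub>" if "u \<in> carrier B" for u
      using that by (simp add: a_minus_def B.r_neg)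
    have "?h r = \<zero>\<^bsub>B\<^esub>"
      using r balanced_mapD [OF \<phi>] unfolding tensor_relations_def
      by (auto simp: h_diff h_of sub M.rsmult_closed N.smult_closed keys_frag_of cancel
          self simp del: carrier_free_Abelian_group_iff)
    with r tensor_relations_subset show "r \<in> kernel F (add_monoid B) ?h"
      by (auto simp: kernel_def simp del: carrier_free_Abelian_group_iff)
  qed
  then have null: "K \<subseteq> kernel F (add_monoid B) ?h"
    unfolding tensor_null_def by (rule F.generate_subgroup_incl) (rule h.subgroup_kernel)
  then have "?h s = ?h t" if "s \<in> K #>\<^bsub>F\<^esub> t" for s
  proof -
    from that obtain k where k: "k \<in> K" "s = k \<otimes>\<^bsub>F\<^esub> t" by (auto simp: r_coset_def)
    then have "k \<in> carrier F" "?h k = \<zero>\<^bsub>B\<^esub>"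
      using null by (auto simp only: kernel_def monoid.simps)
    moreover have "?h t \<in> carrier B"
      using h.hom_closed [OF t] by simp
    ultimately show ?thesis
      using h.hom_mult [of k t] t by (simp only: k monoid.simps B.l_zero)
  qed
  moreover have "t \<in> K #>\<^bsub>F\<^esub> t"
    by (rule F.rcos_self [OF t tensor_null_subgroup])
  ultimately have "?h ` (K #>\<^bsub>F\<^esub> t) = {?h t}"
    by blast
  then show ?thesis
    by (simp only: tensor_lift_def the_elem_eq)
qed

lemma tensor_lift_hom:
  assumes "abelian_group B" and \<phi>: "balanced_map B \<phi>"
  shows "tensor_lift B \<phi> \<in> hom (add_monoid T) (add_monoid B)"
proof -
  interpret F: group F by simp
  have "(\<lambda>t. \<Oplus>\<^bsub>B\<^esub>p\<in>Poly_Mapping.keys t. add_pow B (Poly_Mapping.lookup t p) (\<phi> (fst p) (snd p)))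
      \<in> hom F (add_monoid B)"
    by (rule frag_sum_hom [OF assms(1)]) (use balanced_mapD(1) [OF \<phi>] in auto)
  then have hom: "(\<lambda>t. tensor_lift B \<phi> (K #>\<^bsub>F\<^esub> t)) \<in> hom F (add_monoid B)"
    by (rule hom_cong_carrier [OF _ F.is_group]) (simp only: tensor_lift_coset [OF assms])
  show ?thesis
  proof (rule homI)
    fix X assume "X \<in> carrier (add_monoid T)"
    then obtain t where "t \<in> carrier F" "X = K #>\<^bsub>F\<^esub> t"
      by (auto simp only: carrier_tensor monoid.simps partial_object.simps)
    then show "tensor_lift B \<phi> X \<in> carrier (add_monoid B)"
      by (simp only: hom_in_carrier [OF hom])
  next
    fix X Y assume "X \<in> carrier (add_monoid T)" "Y \<in> carrier (add_monoid T)"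
    then obtain t u where "t \<in> carrier F" "u \<in> carrier F" "X = K #>\<^bsub>F\<^esub> t" "Y = K #>\<^bsub>F\<^esub> u"
      by (auto simp: carrier_tensor)
    then show "tensor_lift B \<phi> (X \<otimes>\<^bsub>add_monoid T\<^esub> Y) =
        tensor_lift B \<phi> X \<otimes>\<^bsub>add_monoid B\<^esub> tensor_lift B \<phi> Y"
      by (simp only: add_coset hom_mult [OF hom, of t u, unfolded mult_free_Abelian_group] monoid.simps)
  qed
qed

lemma tensor_lift_pure:
  assumes "abelian_group B" and \<phi>: "balanced_map B \<phi>" and xy: "x \<in> carrier M" "y \<in> carrier N"
  shows "tensor_lift B \<phi> (pure_tensor A M N x y) = \<phi> x y"
proof -
  interpret B: abelian_group B by fact
  show ?thesis
    using balanced_mapD(1) [OF \<phi> xy] xy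
    by (simp add: pure_tensor_def tensor_lift_coset [OF assms(1,2)] keys_frag_of)
qed

text \<open>
  Uniqueness in the universal property: the classes of pairs generate the tensor product, so an identity
  between additive maps need only be checked on pure tensors. The identities between
  lifts below are obtained in this way.
\<close>

lemma tensor_hom_eqI:
  assumes "abelian_group B"
    and h: "h \<in> hom (add_monoid T) (add_monoid B)" and k: "k \<in> hom (add_monoid T) (add_monoid B)"
    and eq: "\<And>x y. \<lbrakk>x \<in> carrier M; y \<in> carrier N\<rbrakk> \<Longrightarrow>
      h (pure_tensor A M N x y) = k (pure_tensor A M N x y)"
    and X: "X \<in> carrier T"
  shows "h X = k X"
proof -
  interpret B: abelian_group B by fact
  interpret F: group F by simp
  obtain t where t: "Poly_Mapping.keys t \<subseteq> carrier M \<times> carrier N" and X: "X = K #>\<^bsub>F\<^esub> t"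
    using X by (auto simp: carrier_tensor)
  interpret h: group_hom F "add_monoid B" "\<lambda>t. h (K #>\<^bsub>F\<^esub> t)"
    using hom_compose [OF coset_hom h] by unfold_locales (simp add: comp_def)
  interpret k: group_hom F "add_monoid B" "\<lambda>t. k (K #>\<^bsub>F\<^esub> t)"
    using hom_compose [OF coset_hom k] by unfold_locales (simp add: comp_def)
  have "h (K #>\<^bsub>F\<^esub> t) = k (K #>\<^bsub>F\<^esub> t)"
    using t
  proof (induction rule: free_Abelian_group_induct [consumes 1])
    case 1
    show ?case using h.hom_one k.hom_one by simp
  next
    case (2 t u)
    then have "t \<in> carrier F" "u \<in> carrier F" and tu: "t - u = t \<otimes>\<^bsub>F\<^esub> inv\<^bsub>F\<^esub> u"
      by simp_all
    then show ?case
      using 2 unfolding tu by (simp only: h.hom_mult k.hom_mult h.hom_inv k.hom_inv F.inv_closed)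
  next
    case (3 p)
    then show ?case
      using eq by (auto simp: pure_tensor_def)
  qed
  then show ?thesis by (simp add: X)
qed

lemma coset_diff_eq:
  assumes "t \<in> carrier F" "u \<in> carrier F" "t - u \<in> K"
  shows "K #>\<^bsub>F\<^esub> t = K #>\<^bsub>F\<^esub> u"
proof -
  interpret F: group F by simp
  have "t = (t - u) \<otimes>\<^bsub>F\<^esub> u" by simp
  then have "t \<in> K #>\<^bsub>F\<^esub> u"
    using assms(3) unfolding r_coset_def by blast
  then show ?thesis
    using F.repr_independence assms(2) tensor_null_subgroup by metis
qed

lemma tensor_relations_in_null: "tensor_relations A M N \<subseteq> K"
  unfolding tensor_null_def by (auto intro: generate.incl)

lemma balanced_pure_tensor: "balanced_map T (pure_tensor A M N)"
proof (rule balanced_mapI)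
  fix x x' y assume *: "x \<in> carrier M" "x' \<in> carrier M" "y \<in> carrier N"
  let ?r = "frag_of (x \<oplus>\<^bsub>M\<^esub> x', y)" let ?s = "frag_of (x, y)" let ?t = "frag_of (x', y)"
  have "?r - ?s - ?t \<in> tensor_relations A M N"
    using * unfolding tensor_relations_def by blast
  then have "K #>\<^bsub>F\<^esub> ?r = K #>\<^bsub>F\<^esub> (?s + ?t)"
    using * tensor_relations_in_null
    by (intro coset_diff_eq) (auto simp: diff_diff_eq keys_frag_of dest!: subsetD [OF keys_add])
  with * show "pure_tensor A M N (x \<oplus>\<^bsub>M\<^esub> x') y =
      pure_tensor A M N x y \<oplus>\<^bsub>T\<^esub> pure_tensor A M N x' y"
    by (simp add: pure_tensor_def add_coset keys_frag_of)
next
  fix x y y' assume *: "x \<in> carrier M" "y \<in> carrier N" "y' \<in> carrier N"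
  let ?r = "frag_of (x, y \<oplus>\<^bsub>N\<^esub> y')" let ?s = "frag_of (x, y)" let ?t = "frag_of (x, y')"
  have "?r - ?s - ?t \<in> tensor_relations A M N"
    using * unfolding tensor_relations_def by blast
  then have "K #>\<^bsub>F\<^esub> ?r = K #>\<^bsub>F\<^esub> (?s + ?t)"
    using * tensor_relations_in_null
    by (intro coset_diff_eq) (auto simp: diff_diff_eq keys_frag_of dest!: subsetD [OF keys_add])
  with * show "pure_tensor A M N x (y \<oplus>\<^bsub>N\<^esub> y') =
      pure_tensor A M N x y \<oplus>\<^bsub>T\<^esub> pure_tensor A M N x y'"
    by (simp add: pure_tensor_def add_coset keys_frag_of)
next
  fix x a y assume *: "x \<in> carrier M" "a \<in> carrier A" "y \<in> carrier N"
  have "frag_of (x \<odot>\<^sub>r\<^bsub>M\<^esub> a, y) - frag_of (x, a \<odot>\<^bsub>N\<^esub> y) \<in> tensor_relations A M N"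
    using * unfolding tensor_relations_def by blast
  then show "pure_tensor A M N (x \<odot>\<^sub>r\<^bsub>M\<^esub> a) y = pure_tensor A M N x (a \<odot>\<^bsub>N\<^esub> y)"
    unfolding pure_tensor_def using * tensor_relations_in_null
    by (intro coset_diff_eq) (auto simp: keys_frag_of M.rsmult_closed N.smult_closed)
qed (rule pure_tensor_in)

lemmas pure_tensor_rules = balanced_mapD [OF balanced_pure_tensor]

text \<open>
  The left action on the tensor product is itself a lift, whose target is \<open>tensor_group\<close> because
  it is used to build the bimodule. The latter has the same additive structure, which turns the universal
  property of the former into statements about the bimodule.
\<close>

lemma
  assumes a: "a \<in> carrier A"
  shows tensor_smult_hom: "(\<lambda>X. a \<odot>\<^bsub>T\<^esub> X) \<in> hom (add_monoid T) (add_monoid T)"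
    and tensor_smult_pure: "\<lbrakk>x \<in> carrier M; y \<in> carrier N\<rbrakk> \<Longrightarrow>
      a \<odot>\<^bsub>T\<^esub> pure_tensor A M N x y = pure_tensor A M N (a \<odot>\<^bsub>M\<^esub> x) y"
proof -
  let ?T = "tensor_group A M N"
  have T: "carrier ?T = carrier T" "add ?T = add T" "ring.zero ?T = ring.zero T"
    by (simp_all add: tensor_bimodule_def Let_def)
  have smult: "a \<odot>\<^bsub>T\<^esub> X = tensor_lift ?T (\<lambda>x y. pure_tensor A M N (a \<odot>\<^bsub>M\<^esub> x) y) X" for X
    by (simp add: tensor_bimodule_def Let_def)
  have bal: "balanced_map ?T (\<lambda>x y. pure_tensor A M N (a \<odot>\<^bsub>M\<^esub> x) y)"
    using a by (intro balanced_mapI)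
      (simp_all add: T M.smult_closed M.smult_r_distr M.smult_rsmult [symmetric] pure_tensor_rules)
  show "(\<lambda>X. a \<odot>\<^bsub>T\<^esub> X) \<in> hom (add_monoid T) (add_monoid T)"
    using tensor_lift_hom [OF abelian_group_tensor_group bal] by (simp add: smult hom_def T)
  show "a \<odot>\<^bsub>T\<^esub> pure_tensor A M N x y = pure_tensor A M N (a \<odot>\<^bsub>M\<^esub> x) y"
    if "x \<in> carrier M" "y \<in> carrier N"
    by (simp only: smult tensor_lift_pure [OF abelian_group_tensor_group bal that])
qed

lemma tensor_lift_cong:
  assumes "abelian_group B" "balanced_map B \<phi>"
    and eq: "\<And>x y. \<lbrakk>x \<in> carrier M; y \<in> carrier N\<rbrakk> \<Longrightarrow> \<phi> x y = \<psi> x y" and X: "X \<in> carrier T"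
  shows "tensor_lift B \<phi> X = tensor_lift B \<psi> X"
proof -
  have \<psi>: "balanced_map B \<psi>"
    by (rule balanced_mapI)
      (simp_all add: eq [symmetric] balanced_mapD [OF assms(2)] N.smult_closed M.rsmult_closed)
  note lift_hom = tensor_lift_hom [OF assms(1,2)] tensor_lift_hom [OF assms(1) \<psi>]
  note lift_pure = tensor_lift_pure [OF assms(1,2)] tensor_lift_pure [OF assms(1) \<psi>]
  show ?thesis
    by (rule tensor_hom_eqI [OF assms(1) lift_hom _ X]) (simp add: lift_pure eq)
qed

end

lemma bimodule_mapsD:
  assumes "f \<in> bimodule_maps A M N"
  shows "x \<in> carrier M \<Longrightarrow> f x \<in> carrier N"
    and "\<lbrakk>x \<in> carrier M; y \<in> carrier M\<rbrakk> \<Longrightarrow> f (x \<oplus>\<^bsub>M\<^esub> y) = f x \<oplus>\<^bsub>N\<^esub> f y"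
    and "\<lbrakk>a \<in> carrier A; x \<in> carrier M\<rbrakk> \<Longrightarrow> f (a \<odot>\<^bsub>M\<^esub> x) = a \<odot>\<^bsub>N\<^esub> f x"
    and "\<lbrakk>x \<in> carrier M; a \<in> carrier A\<rbrakk> \<Longrightarrow> f (x \<odot>\<^sub>r\<^bsub>M\<^esub> a) = f x \<odot>\<^sub>r\<^bsub>N\<^esub> a"
  using assms by (auto simp: bimodule_maps_def left_linear_maps_def)

lemma balanced_map_comp:
  assumes MN: "bimodule_pair A M N" and MN': "bimodule_pair A M' N'"
    and f: "f \<in> bimodule_maps A M M'" and g: "g \<in> bimodule_maps A N N'"
    and \<phi>: "bimodule_pair.balanced_map A M' N' B \<phi>"
  shows "bimodule_pair.balanced_map A M N B (\<lambda>x y. \<phi> (f x) (g y))"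
proof -
  interpret MN: bimodule_pair A M N by fact
  interpret MN': bimodule_pair A M' N' by fact
  show ?thesis
    using MN'.balanced_mapD [OF \<phi>]
    by (intro MN.balanced_mapI) (simp_all add: bimodule_mapsD [OF f] bimodule_mapsD [OF g])
qed

lemma tensor_map_hom:
  assumes MN: "bimodule_pair A M N" and MN': "bimodule_pair A M' N'"
    and f: "f \<in> bimodule_maps A M M'" and g: "g \<in> bimodule_maps A N N'"
  shows "tensor_map A M' N' f g \<in> hom (add_monoid (tensor_bimodule A M N)) (add_monoid (tensor_bimodule A M' N'))"
  unfolding tensor_map_def
  by (rule bimodule_pair.tensor_lift_hom [OF MN bimodule_pair.abelian_group_tensor [OF MN']
        balanced_map_comp [OF MN MN' f g bimodule_pair.balanced_pure_tensor [OF MN']]])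

text \<open>
  A lift after \<open>f \<otimes> g\<close> is again a lift. The target \<open>B\<close> is arbitrary: with \<open>B = A\<close> this transports the
  multiplication of the dual ring along a cofree structure, and with a tensor product as \<open>B\<close> it gives
  functoriality of \<open>\<otimes>\<close>.
\<close>

lemma tensor_lift_tensor_map:
  assumes MN: "bimodule_pair A M N" and MN': "bimodule_pair A M' N'"
    and f: "f \<in> bimodule_maps A M M'" and g: "g \<in> bimodule_maps A N N'"
    and B: "abelian_group B" and \<phi>: "bimodule_pair.balanced_map A M' N' B \<phi>"
    and X: "X \<in> carrier (tensor_bimodule A M N)"
  shows "tensor_lift B \<phi> (tensor_map A M' N' f g X) = tensor_lift B (\<lambda>x y. \<phi> (f x) (g y)) X"
proof -
  interpret MN: bimodule_pair A M N by fact
  interpret MN': bimodule_pair A M' N' by fact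
  have hom: "(\<lambda>X. tensor_lift B \<phi> (tensor_map A M' N' f g X)) \<in> hom (add_monoid MN.T) (add_monoid B)"
    using hom_compose [OF tensor_map_hom [OF MN MN' f g] MN'.tensor_lift_hom [OF B \<phi>]]
    by (simp add: comp_def)
  have map_pure: "tensor_map A M' N' f g (pure_tensor A M N x y) = pure_tensor A M' N' (f x) (g y)"
    if "x \<in> carrier M" "y \<in> carrier N" for x y
    unfolding tensor_map_def
    by (rule MN.tensor_lift_pure [OF MN'.abelian_group_tensor
          balanced_map_comp [OF MN MN' f g MN'.balanced_pure_tensor] that])
  have bal: "MN.balanced_map B (\<lambda>x y. \<phi> (f x) (g y))"
    by (rule balanced_map_comp [OF MN MN' f g \<phi>])
  show ?thesis
    by (rule MN.tensor_hom_eqI [OF B hom MN.tensor_lift_hom [OF B bal] _ X])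
      (simp add: map_pure MN.tensor_lift_pure [OF B bal] MN'.tensor_lift_pure [OF B \<phi>]
        bimodule_mapsD [OF f] bimodule_mapsD [OF g])
qed

lemma tensor_map_comp:
  assumes MN: "bimodule_pair A M N" and MN': "bimodule_pair A M' N'" and MN'': "bimodule_pair A M'' N''"
    and f: "f \<in> bimodule_maps A M M'" and g: "g \<in> bimodule_maps A N N'"
    and f': "f' \<in> bimodule_maps A M' M''" and g': "g' \<in> bimodule_maps A N' N''"
    and X: "X \<in> carrier (tensor_bimodule A M N)"
  shows "tensor_map A M'' N'' f' g' (tensor_map A M' N' f g X) =
    tensor_map A M'' N'' (\<lambda>x. f' (f x)) (\<lambda>y. g' (g y)) X"
proof -
  note T'' = bimodule_pair.abelian_group_tensor [OF MN'']
  note bal = balanced_map_comp [OF MN' MN'' f' g' bimodule_pair.balanced_pure_tensor [OF MN'']]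
  show ?thesis
    unfolding tensor_map_def [of A M'' N'']
    by (rule tensor_lift_tensor_map [OF MN MN' f g T'' bal X])
qed

lemma tensor_map_cong:
  assumes MN: "bimodule_pair A M N" and MN': "bimodule_pair A M' N'"
    and f': "f' \<in> bimodule_maps A M M'" and g': "g' \<in> bimodule_maps A N N'"
    and "\<And>x. x \<in> carrier M \<Longrightarrow> f x = f' x" and "\<And>y. y \<in> carrier N \<Longrightarrow> g y = g' y"
    and X: "X \<in> carrier (tensor_bimodule A M N)"
  shows "tensor_map A M' N' f g X = tensor_map A M' N' f' g' X"
  unfolding tensor_map_def
  by (rule bimodule_pair.tensor_lift_cong [OF MN bimodule_pair.abelian_group_tensor [OF MN']
        balanced_map_comp [OF MN MN' f' g' bimodule_pair.balanced_pure_tensor [OF MN']] _ X, symmetric])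
    (simp add: assms(5,6))

section \<open>Left duals of bimodules\<close>

lemma left_dual_carrierI:
  assumes "\<And>x. x \<in> carrier M \<Longrightarrow> f x \<in> carrier A"
    and "\<And>x y. \<lbrakk>x \<in> carrier M; y \<in> carrier M\<rbrakk> \<Longrightarrow> f (x \<oplus>\<^bsub>M\<^esub> y) = f x \<oplus>\<^bsub>A\<^esub> f y"
    and "\<And>a x. \<lbrakk>a \<in> carrier A; x \<in> carrier M\<rbrakk> \<Longrightarrow> f (a \<odot>\<^bsub>M\<^esub> x) = a \<otimes>\<^bsub>A\<^esub> f x"
    and "bimodule A M"
  shows "restrict f (carrier M) \<in> carrier (left_dual A M)"
proof -
  interpret bimodule A M by fact
  show ?thesis
    using assms(1-3) by (simp add: left_dual_def left_linear_maps_def regular_bimodule_def smult_closed)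
qed

lemma left_dual_carrierD:
  assumes "f \<in> carrier (left_dual A M)"
  shows "x \<in> carrier M \<Longrightarrow> f x \<in> carrier A"
    and "\<lbrakk>x \<in> carrier M; y \<in> carrier M\<rbrakk> \<Longrightarrow> f (x \<oplus>\<^bsub>M\<^esub> y) = f x \<oplus>\<^bsub>A\<^esub> f y"
    and "\<lbrakk>a \<in> carrier A; x \<in> carrier M\<rbrakk> \<Longrightarrow> f (a \<odot>\<^bsub>M\<^esub> x) = a \<otimes>\<^bsub>A\<^esub> f x"
    and "f \<in> extensional (carrier M)"
  using assms by (auto simp: left_dual_def left_linear_maps_def regular_bimodule_def)

lemma add_left_dual: "f \<oplus>\<^bsub>left_dual A M\<^esub> g = (\<lambda>x\<in>carrier M. f x \<oplus>\<^bsub>A\<^esub> g x)"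
  and zero_left_dual: "\<zero>\<^bsub>left_dual A M\<^esub> = (\<lambda>x\<in>carrier M. \<zero>\<^bsub>A\<^esub>)"
  by (simp_all add: left_dual_def)

lemma abelian_group_left_dual:
  assumes "bimodule A M"
  shows "abelian_group (left_dual A M)"
proof -
  interpret M: bimodule A M by fact
  note D = left_dual_carrierD
  show ?thesis
  proof (rule abelian_groupI, goal_cases)
    case (1 f g)
    then show ?case
      unfolding add_left_dual
      by (intro left_dual_carrierI assms)
        (simp_all add: D [OF 1(1)] D [OF 1(2)] M.smult_closed M.A.a_ac M.A.r_distr)
  next
    case 2
    show ?case
      unfolding zero_left_dual by (intro left_dual_carrierI assms) simp_all
  next
    case (3 f g h)
    then show ?case
      by (auto simp: add_left_dual D(1) M.A.a_assoc intro!: restrict_ext)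
  next
    case (4 f g)
    then show ?case
      by (auto simp: add_left_dual D(1) M.A.a_comm intro!: restrict_ext)
  next
    case (5 f)
    then show ?case
      by (intro extensionalityI [of _ "carrier M"])
        (auto simp: add_left_dual zero_left_dual D(1) D(4))
  next
    case (6 f)
    have "(\<lambda>x\<in>carrier M. \<ominus>\<^bsub>A\<^esub> f x) \<in> carrier (left_dual A M)"
      by (intro left_dual_carrierI assms) (simp_all add: D [OF 6] M.A.minus_add M.A.r_minus)
    moreover have "(\<lambda>x\<in>carrier M. \<ominus>\<^bsub>A\<^esub> f x) \<oplus>\<^bsub>left_dual A M\<^esub> f = \<zero>\<^bsub>left_dual A M\<^esub>"
      by (auto simp: add_left_dual zero_left_dual D(1) [OF 6] M.A.l_neg intro!: restrict_ext)
    ultimately show ?case by blast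
  qed
qed

definition pullback :: "('a, 'm) bimodule \<Rightarrow> ('m \<Rightarrow> 'n) \<Rightarrow> ('n \<Rightarrow> 'a) \<Rightarrow> 'm \<Rightarrow> 'a" where
  "pullback M \<gamma> f = (\<lambda>x\<in>carrier M. f (\<gamma> x))"

lemma pullback_closed:
  assumes M: "bimodule A M" and \<gamma>: "\<gamma> \<in> bimodule_maps A M N" and f: "f \<in> carrier (left_dual A N)"
  shows "pullback M \<gamma> f \<in> carrier (left_dual A M)"
  unfolding pullback_def
  by (intro left_dual_carrierI M) (simp_all add: bimodule_mapsD [OF \<gamma>] left_dual_carrierD [OF f])

lemma bimodule_isos_comp:
  assumes "f \<in> bimodule_isos A M N" "g \<in> bimodule_isos A N P"
  shows "(\<lambda>x. g (f x)) \<in> bimodule_isos A M P"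
  using assms bij_betw_trans [of f "carrier M" "carrier N" g "carrier P"]
  by (auto simp: bimodule_isos_def bimodule_maps_def left_linear_maps_def comp_def Pi_iff)

lemma bimodule_isos_inv_into:
  assumes M: "bimodule A M" and \<gamma>: "\<gamma> \<in> bimodule_isos A M N"
  shows "inv_into (carrier M) \<gamma> \<in> bimodule_isos A N M"
proof -
  interpret M: bimodule A M by fact
  have map: "\<gamma> \<in> bimodule_maps A M N" and bij: "bij_betw \<gamma> (carrier M) (carrier N)"
    using \<gamma> by (auto simp: bimodule_isos_def)
  define \<delta> where "\<delta> = inv_into (carrier M) \<gamma>"
  have \<delta>: "\<delta> y \<in> carrier M" "\<gamma> (\<delta> y) = y" if "y \<in> carrier N" for y
    using bij that by (auto simp: \<delta>_def bij_betw_def inv_into_into f_inv_into_f)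
  have \<delta>\<gamma>: "\<delta> (\<gamma> x) = x" if "x \<in> carrier M" for x
    using bij that by (simp add: \<delta>_def bij_betw_def)
  have "\<delta> \<in> bimodule_maps A N M"
    unfolding bimodule_maps_def left_linear_maps_def
  proof (intro CollectI conjI ballI)
    show "\<delta> \<in> carrier N \<rightarrow> carrier M" using \<delta> by auto
  next
    fix x y assume "x \<in> carrier N" "y \<in> carrier N"
    then show "\<delta> (x \<oplus>\<^bsub>N\<^esub> y) = \<delta> x \<oplus>\<^bsub>M\<^esub> \<delta> y"
      using \<delta>\<gamma> [of "\<delta> x \<oplus>\<^bsub>M\<^esub> \<delta> y"] by (simp add: bimodule_mapsD [OF map] \<delta>)
  next
    fix a x assume "a \<in> carrier A" "x \<in> carrier N"
    then show "\<delta> (a \<odot>\<^bsub>N\<^esub> x) = a \<odot>\<^bsub>M\<^esub> \<delta> x"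
      using \<delta>\<gamma> [of "a \<odot>\<^bsub>M\<^esub> \<delta> x"] by (simp add: bimodule_mapsD [OF map] \<delta> M.smult_closed)
  next
    fix x a assume "x \<in> carrier N" "a \<in> carrier A"
    then show "\<delta> (x \<odot>\<^sub>r\<^bsub>N\<^esub> a) = \<delta> x \<odot>\<^sub>r\<^bsub>M\<^esub> a"
      using \<delta>\<gamma> [of "\<delta> x \<odot>\<^sub>r\<^bsub>M\<^esub> a"] by (simp add: bimodule_mapsD [OF map] \<delta> M.rsmult_closed)
  qed
  then show ?thesis
    using bij_betw_inv_into [OF bij] by (simp add: bimodule_isos_def \<delta>_def)
qed

lemma pullback_iso:
  assumes M: "bimodule A M" and N: "bimodule A N" and \<gamma>: "\<gamma> \<in> bimodule_isos A M N"
  shows "pullback M \<gamma> \<in> iso (add_monoid (left_dual A N)) (add_monoid (left_dual A M))"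
proof (rule isoI)
  have map: "\<gamma> \<in> bimodule_maps A M N" and bij: "bij_betw \<gamma> (carrier M) (carrier N)"
    using \<gamma> by (auto simp: bimodule_isos_def)
  show "pullback M \<gamma> \<in> hom (add_monoid (left_dual A N)) (add_monoid (left_dual A M))"
    using pullback_closed [OF M map]
    by (auto simp: hom_def add_left_dual pullback_def bimodule_mapsD [OF map] intro!: restrict_ext)
  define \<delta> where "\<delta> = inv_into (carrier M) \<gamma>"
  have \<delta>_map: "\<delta> \<in> bimodule_maps A N M"
    using bimodule_isos_inv_into [OF M \<gamma>] by (simp add: \<delta>_def bimodule_isos_def)
  have \<gamma>\<delta>: "\<gamma> (\<delta> y) = y" if "y \<in> carrier N" for y
    using bij that by (auto simp: \<delta>_def bij_betw_def f_inv_into_f)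
  have \<delta>\<gamma>: "\<delta> (\<gamma> x) = x" if "x \<in> carrier M" for x
    using bij that by (simp add: \<delta>_def bij_betw_def)
  show "bij_betw (pullback M \<gamma>) (carrier (add_monoid (left_dual A N))) (carrier (add_monoid (left_dual A M)))"
  proof (rule bij_betw_byWitness [where f' = "pullback N \<delta>"])
    show "\<forall>f\<in>carrier (add_monoid (left_dual A N)). pullback N \<delta> (pullback M \<gamma> f) = f"
    proof
      fix f assume "f \<in> carrier (add_monoid (left_dual A N))"
      then have "f \<in> extensional (carrier N)" by (simp add: left_dual_carrierD(4))
      then show "pullback N \<delta> (pullback M \<gamma> f) = f"
        by (rule extensionalityI [rotated]) (simp_all add: pullback_def \<gamma>\<delta> bimodule_mapsD [OF \<delta>_map])
    qed
    show "\<forall>f\<in>carrier (add_monoid (left_dual A M)). pullback M \<gamma> (pullback N \<delta> f) = f"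
    proof
      fix f assume "f \<in> carrier (add_monoid (left_dual A M))"
      then have "f \<in> extensional (carrier M)" by (simp add: left_dual_carrierD(4))
      then show "pullback M \<gamma> (pullback N \<delta> f) = f"
        by (rule extensionalityI [rotated]) (simp_all add: pullback_def \<delta>\<gamma> bimodule_mapsD [OF map])
    qed
  qed (use pullback_closed [OF M map] pullback_closed [OF N \<delta>_map] in auto)
qed

text \<open>
  The right action on \<open>M\<close> is what makes \<open>x \<otimes> y \<mapsto> g (x (f y))\<close> balanced: left linearity of \<open>f\<close> turns
  \<open>f (a y)\<close> into \<open>a (f y)\<close>, which is absorbed by associativity of that action.
\<close>

lemma balanced_map_dual:
  assumes MN: "bimodule_pair A M N" and f: "f \<in> carrier (left_dual A N)" and g: "g \<in> carrier (left_dual A M)"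
  shows "bimodule_pair.balanced_map A M N A (\<lambda>x y. g (x \<odot>\<^sub>r\<^bsub>M\<^esub> f y))"
proof -
  interpret bimodule_pair A M N by fact
  show ?thesis
    by (rule balanced_mapI)
      (simp_all add: left_dual_carrierD [OF f] left_dual_carrierD [OF g] M.rsmult_closed M.rsmult_l_distr
        M.rsmult_r_distr M.rsmult_assoc)
qed

text \<open>
  Left linearity of the product \<open>g (c\<^sub>1 f(c\<^sub>2))\<close>: on pure tensors a left scalar can be moved out through \<open>M\<close>
  and the left linear map \<open>g\<close>, and the comultiplication \<open>d\<close> is itself left linear.
\<close>

lemma convolution_closed:
  assumes MN: "bimodule_pair A M N" and f: "f \<in> carrier (left_dual A N)" and g: "g \<in> carrier (left_dual A M)"
    and D: "bimodule A D" and d: "d \<in> bimodule_maps A D (tensor_bimodule A M N)"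
  shows "(\<lambda>c\<in>carrier D. tensor_lift A (\<lambda>x y. g (x \<odot>\<^sub>r\<^bsub>M\<^esub> f y)) (d c)) \<in> carrier (left_dual A D)"
proof -
  interpret bimodule_pair A M N by fact
  let ?\<phi> = "\<lambda>x y. g (x \<odot>\<^sub>r\<^bsub>M\<^esub> f y)"
  note f = left_dual_carrierD [OF f] and g = left_dual_carrierD [OF g]
  have A: "abelian_group A" by (rule M.A.abelian_group_axioms)
  have bal: "balanced_map A ?\<phi>" by (rule balanced_map_dual [OF assms(1-3)])
  note lift = tensor_lift_hom [OF A bal]
  have lin: "tensor_lift A ?\<phi> (a \<odot>\<^bsub>T\<^esub> X) = a \<otimes>\<^bsub>A\<^esub> tensor_lift A ?\<phi> X"
    if "a \<in> carrier A" "X \<in> carrier T" for a X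
  proof (rule tensor_hom_eqI [OF A _ _ _ \<open>X \<in> carrier T\<close>])
    show "(\<lambda>X. tensor_lift A ?\<phi> (a \<odot>\<^bsub>T\<^esub> X)) \<in> hom (add_monoid T) (add_monoid A)"
      using hom_compose [OF tensor_smult_hom lift] that by (simp add: comp_def)
    show "(\<lambda>X. a \<otimes>\<^bsub>A\<^esub> tensor_lift A ?\<phi> X) \<in> hom (add_monoid T) (add_monoid A)"
      using lift that by (auto simp: hom_def Pi_iff M.A.r_distr)
    show "tensor_lift A ?\<phi> (a \<odot>\<^bsub>T\<^esub> pure_tensor A M N x y) = a \<otimes>\<^bsub>A\<^esub> tensor_lift A ?\<phi> (pure_tensor A M N x y)"
      if "x \<in> carrier M" "y \<in> carrier N" for x y
      using that \<open>a \<in> carrier A\<close>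
      by (simp add: tensor_smult_pure tensor_lift_pure [OF A bal] M.smult_closed M.smult_rsmult f g
          M.rsmult_closed)
  qed
  show ?thesis
    by (intro left_dual_carrierI D)
      (use hom_in_carrier [OF lift] hom_mult [OF lift] in \<open>simp_all add: bimodule_mapsD [OF d] lin\<close>)
qed


text \<open>
  On pure tensors both sides are \<open>g (\<gamma> x \<cdot> f (\<delta> y))\<close>, since \<open>\<gamma>\<close> commutes with the right
  action by which \<open>f\<close> enters the product.
\<close>

lemma convolution_pullback:
  assumes L: "bimodule_pair A L L'" and MN: "bimodule_pair A M N"
    and \<gamma>: "\<gamma> \<in> bimodule_maps A L M" and \<delta>: "\<delta> \<in> bimodule_maps A L' N"
    and f: "f \<in> carrier (left_dual A N)" and g: "g \<in> carrier (left_dual A M)"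
    and X: "X \<in> carrier (tensor_bimodule A L L')"
  shows "tensor_lift A (\<lambda>x y. g (x \<odot>\<^sub>r\<^bsub>M\<^esub> f y)) (tensor_map A M N \<gamma> \<delta> X) =
    tensor_lift A (\<lambda>x y. pullback L \<gamma> g (x \<odot>\<^sub>r\<^bsub>L\<^esub> pullback L' \<delta> f y)) X"
proof -
  interpret L: bimodule_pair A L L' by fact
  interpret MN: bimodule_pair A M N by fact
  note A = L.M.A.abelian_group_axioms
  note bal = balanced_map_dual [OF MN f g]
  have "tensor_lift A (\<lambda>x y. g (x \<odot>\<^sub>r\<^bsub>M\<^esub> f y)) (tensor_map A M N \<gamma> \<delta> X) =
      tensor_lift A (\<lambda>x y. g (\<gamma> x \<odot>\<^sub>r\<^bsub>M\<^esub> f (\<delta> y))) X"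
    by (rule tensor_lift_tensor_map [OF L MN \<gamma> \<delta> A bal X])
  also have "\<dots> = tensor_lift A (\<lambda>x y. pullback L \<gamma> g (x \<odot>\<^sub>r\<^bsub>L\<^esub> pullback L' \<delta> f y)) X"
    by (rule L.tensor_lift_cong [OF A balanced_map_comp [OF L MN \<gamma> \<delta> bal] _ X])
      (simp add: pullback_def bimodule_mapsD [OF \<gamma>] bimodule_mapsD [OF \<delta>] left_dual_carrierD [OF f]
        L.M.rsmult_closed)
  finally show ?thesis .
qed

section \<open>Isomorphisms of graded rings from their components\<close>

lemma hom_finsum:
  assumes R: "abelian_group R" and S: "abelian_group S"
    and h: "h \<in> hom (add_monoid R) (add_monoid S)" and f: "f \<in> I \<rightarrow> carrier R"
  shows "h (finsum R f I) = finsum S (\<lambda>i. h (f i)) I"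
proof -
  interpret R: abelian_group R by fact
  interpret S: abelian_group S by fact
  interpret h: group_hom "add_monoid R" "add_monoid S" h
    by unfold_locales (rule h)
  show ?thesis
    using f
  proof (induction I rule: infinite_finite_induct)
    case (insert i I)
    then show ?case
      using h.hom_mult [of "f i" "finsum R f I"] hom_in_carrier [OF h]
      by (simp add: R.finsum_insert S.finsum_insert Pi_iff R.finsum_closed)
  qed (use h.hom_one in simp_all)
qed

lemma carrier_graded_sum_ring:
  assumes "\<And>\<alpha>. \<alpha> \<in> carrier G \<Longrightarrow> abelian_group (R \<alpha>)"
  shows "carrier (graded_sum_ring G R mul u) =
    {F \<in> \<Pi>\<^sub>E \<alpha>\<in>carrier G. carrier (R \<alpha>). finite {\<alpha> \<in> carrier G. F \<alpha> \<noteq> \<zero>\<^bsub>R \<alpha>\<^esub>}}"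
  using carrier_sum_group [of "carrier G" "\<lambda>\<alpha>. add_monoid (R \<alpha>)",
      OF abelian_group.a_group [OF assms]]
  by (simp add: graded_sum_ring_def Let_def)

text \<open>
  Componentwise isomorphisms preserve supports, so the finite sums defining a product on both sides range over
  the same pairs of degrees. Additivity of \<open>\<phi> \<gamma>\<close> then reduces multiplicativity to homogeneous elements.
  The map \<open>\<phi> \<gamma>\<close> commutes with the sum only if the summands lie in \<open>R \<gamma>\<close>, which is the role of
  \<open>mul_closed\<close>.
\<close>

lemma graded_sum_ring_isoI:
  fixes G :: "('g, 'h) monoid_scheme" and R :: "'g \<Rightarrow> 'r ring" and S :: "'g \<Rightarrow> 's ring"
  assumes G: "monoid G"
    and R: "\<And>\<alpha>. \<alpha> \<in> carrier G \<Longrightarrow> abelian_group (R \<alpha>)"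
    and S: "\<And>\<alpha>. \<alpha> \<in> carrier G \<Longrightarrow> abelian_group (S \<alpha>)"
    and \<phi>: "\<And>\<alpha>. \<alpha> \<in> carrier G \<Longrightarrow> \<phi> \<alpha> \<in> iso (add_monoid (R \<alpha>)) (add_monoid (S \<alpha>))"
    and mul_closed: "\<And>\<alpha> \<beta> r r'. \<lbrakk>\<alpha> \<in> carrier G; \<beta> \<in> carrier G; r \<in> carrier (R \<alpha>); r' \<in> carrier (R \<beta>)\<rbrakk> \<Longrightarrow>
      mul \<alpha> \<beta> r r' \<in> carrier (R (\<alpha> \<otimes>\<^bsub>G\<^esub> \<beta>))"
    and mul: "\<And>\<alpha> \<beta> r r'. \<lbrakk>\<alpha> \<in> carrier G; \<beta> \<in> carrier G; r \<in> carrier (R \<alpha>); r' \<in> carrier (R \<beta>)\<rbrakk> \<Longrightarrow>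
      \<phi> (\<alpha> \<otimes>\<^bsub>G\<^esub> \<beta>) (mul \<alpha> \<beta> r r') = mul' \<alpha> \<beta> (\<phi> \<alpha> r) (\<phi> \<beta> r')"
    and unit: "\<phi> \<one>\<^bsub>G\<^esub> u = u'"
  defines "RR \<equiv> graded_sum_ring G R mul u" and "SS \<equiv> graded_sum_ring G S mul' u'"
  shows "(\<lambda>F. \<lambda>\<alpha>\<in>carrier G. \<phi> \<alpha> (F \<alpha>)) \<in> graded_ring_isos G RR (homogeneous_part G RR) SS (homogeneous_part G SS)"
proof -
  interpret G: monoid G by fact
  define h where "h = (\<lambda>F. \<lambda>\<alpha>\<in>carrier G. \<phi> \<alpha> (F \<alpha>))"
  define k where "k = (\<lambda>H. \<lambda>\<alpha>\<in>carrier G. inv_into (carrier (R \<alpha>)) (\<phi> \<alpha>) (H \<alpha>))"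
  have hom: "\<phi> \<alpha> \<in> hom (add_monoid (R \<alpha>)) (add_monoid (S \<alpha>))"
    and bij: "bij_betw (\<phi> \<alpha>) (carrier (R \<alpha>)) (carrier (S \<alpha>))" if "\<alpha> \<in> carrier G" for \<alpha>
    using \<phi> [OF that] by (simp_all add: iso_def)
  have \<phi>_closed: "\<phi> \<alpha> r \<in> carrier (S \<alpha>)" if "\<alpha> \<in> carrier G" "r \<in> carrier (R \<alpha>)" for \<alpha> r
    using hom_in_carrier [OF hom] that by simp
  have \<phi>_zero: "\<phi> \<alpha> \<zero>\<^bsub>R \<alpha>\<^esub> = \<zero>\<^bsub>S \<alpha>\<^esub>" if "\<alpha> \<in> carrier G" for \<alpha>
    using hom_one [OF hom [OF that] abelian_group.a_group [OF R [OF that]] abelian_group.a_group [OF S [OF that]]]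
    by simp
  have zero_closed: "\<zero>\<^bsub>R \<alpha>\<^esub> \<in> carrier (R \<alpha>)" if "\<alpha> \<in> carrier G" for \<alpha>
    using R [OF that] by (simp add: abelian_group_def abelian_monoid.zero_closed)
  have \<phi>_zero_iff: "\<phi> \<alpha> r = \<zero>\<^bsub>S \<alpha>\<^esub> \<longleftrightarrow> r = \<zero>\<^bsub>R \<alpha>\<^esub>" if "\<alpha> \<in> carrier G" "r \<in> carrier (R \<alpha>)" for \<alpha> r
    using bij [OF that(1)] \<phi>_zero [OF that(1)] zero_closed [OF that(1)] that(2)
    by (metis bij_betw_imp_inj_on inj_onD)
  have inv: "inv_into (carrier (R \<alpha>)) (\<phi> \<alpha>) s \<in> carrier (R \<alpha>)"
    "\<phi> \<alpha> (inv_into (carrier (R \<alpha>)) (\<phi> \<alpha>) s) = s" if "\<alpha> \<in> carrier G" "s \<in> carrier (S \<alpha>)" for \<alpha> s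
    using bij [OF that(1)] that(2) by (auto simp: bij_betw_def inv_into_into f_inv_into_f)
  have carrier_RR: "F \<in> carrier RR \<longleftrightarrow> F \<in> (\<Pi>\<^sub>E \<alpha>\<in>carrier G. carrier (R \<alpha>)) \<and>
      finite {\<alpha> \<in> carrier G. F \<alpha> \<noteq> \<zero>\<^bsub>R \<alpha>\<^esub>}" for F
    using carrier_graded_sum_ring [of G R] R by (simp add: RR_def)
  have carrier_SS: "H \<in> carrier SS \<longleftrightarrow> H \<in> (\<Pi>\<^sub>E \<alpha>\<in>carrier G. carrier (S \<alpha>)) \<and>
      finite {\<alpha> \<in> carrier G. H \<alpha> \<noteq> \<zero>\<^bsub>S \<alpha>\<^esub>}" for H
    using carrier_graded_sum_ring [of G S] S by (simp add: SS_def)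
  have comp: "F \<alpha> \<in> carrier (R \<alpha>)" if "F \<in> carrier RR" "\<alpha> \<in> carrier G" for F \<alpha>
    using that by (auto simp: carrier_RR)
  have supp: "{\<alpha> \<in> carrier G. h F \<alpha> \<noteq> \<zero>\<^bsub>S \<alpha>\<^esub>} = {\<alpha> \<in> carrier G. F \<alpha> \<noteq> \<zero>\<^bsub>R \<alpha>\<^esub>}" if "F \<in> carrier RR" for F
    using comp [OF that] by (auto simp: h_def \<phi>_zero_iff)
  have h_closed: "h F \<in> carrier SS" if "F \<in> carrier RR" for F
    using supp [OF that] that comp [OF that] \<phi>_closed
    by (simp add: carrier_RR carrier_SS) (simp add: h_def)
  have k_closed: "k H \<in> carrier RR" and hk: "h (k H) = H" if "H \<in> carrier SS" for H
  proof -
    have H: "H \<alpha> \<in> carrier (S \<alpha>)" if "\<alpha> \<in> carrier G" for \<alpha>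
      using \<open>H \<in> carrier SS\<close> that by (auto simp: carrier_SS)
    have k_comp: "k H \<alpha> \<in> carrier (R \<alpha>)" "\<phi> \<alpha> (k H \<alpha>) = H \<alpha>" if "\<alpha> \<in> carrier G" for \<alpha>
      using inv [OF that H [OF that]] that by (simp_all add: k_def)
    show "h (k H) = H"
      using that k_comp by (intro extensionalityI [of _ "carrier G"]) (auto simp: h_def carrier_SS PiE_iff)
    have "{\<alpha> \<in> carrier G. k H \<alpha> \<noteq> \<zero>\<^bsub>R \<alpha>\<^esub>} = {\<alpha> \<in> carrier G. H \<alpha> \<noteq> \<zero>\<^bsub>S \<alpha>\<^esub>}"
      using k_comp \<phi>_zero_iff by fastforce
    then show "k H \<in> carrier RR"
      using that k_comp(1) by (simp add: carrier_RR carrier_SS) (simp add: k_def)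
  qed
  have kh: "k (h F) = F" if "F \<in> carrier RR" for F
    using that comp [OF that]
    by (intro extensionalityI [of _ "carrier G"])
      (auto simp: h_def k_def carrier_RR PiE_iff bij_betw_inv_into_left [OF bij])
  have "h \<in> ring_hom RR SS"
  proof (rule ring_hom_memI)
    fix F H assume F: "F \<in> carrier RR" and H: "H \<in> carrier RR"
    show "h F \<in> carrier SS" using F by (rule h_closed)
    show "h (F \<oplus>\<^bsub>RR\<^esub> H) = h F \<oplus>\<^bsub>SS\<^esub> h H"
      using hom_mult [OF hom] comp [OF F] comp [OF H]
      by (auto simp: h_def RR_def SS_def graded_sum_ring_def Let_def intro!: restrict_ext)
    let ?I = "\<lambda>\<gamma>. {(\<alpha>, \<beta>). \<alpha> \<in> {\<alpha> \<in> carrier G. F \<alpha> \<noteq> \<zero>\<^bsub>R \<alpha>\<^esub>} \<and>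
      \<beta> \<in> {\<beta> \<in> carrier G. H \<beta> \<noteq> \<zero>\<^bsub>R \<beta>\<^esub>} \<and> \<alpha> \<otimes>\<^bsub>G\<^esub> \<beta> = \<gamma>}"
    have "h (F \<otimes>\<^bsub>RR\<^esub> H) = (\<lambda>\<gamma>\<in>carrier G. \<phi> \<gamma> (finsum (R \<gamma>) (\<lambda>(\<alpha>, \<beta>). mul \<alpha> \<beta> (F \<alpha>) (H \<beta>)) (?I \<gamma>)))"
      by (auto simp: h_def RR_def graded_sum_ring_def Let_def intro!: restrict_ext)
    also have "\<dots> = (\<lambda>\<gamma>\<in>carrier G. finsum (S \<gamma>) (\<lambda>(\<alpha>, \<beta>). mul' \<alpha> \<beta> (h F \<alpha>) (h H \<beta>)) (?I \<gamma>))"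
    proof (rule restrict_ext)
      fix \<gamma> assume \<gamma>: "\<gamma> \<in> carrier G"
      interpret S\<gamma>: abelian_group "S \<gamma>" using S \<gamma> .
      have closed: "(\<lambda>(\<alpha>, \<beta>). mul \<alpha> \<beta> (F \<alpha>) (H \<beta>)) \<in> ?I \<gamma> \<rightarrow> carrier (R \<gamma>)"
        using mul_closed comp [OF F] comp [OF H] by auto
      have "\<phi> \<gamma> (finsum (R \<gamma>) (\<lambda>(\<alpha>, \<beta>). mul \<alpha> \<beta> (F \<alpha>) (H \<beta>)) (?I \<gamma>)) =
          finsum (S \<gamma>) (\<lambda>p. \<phi> \<gamma> (case p of (\<alpha>, \<beta>) \<Rightarrow> mul \<alpha> \<beta> (F \<alpha>) (H \<beta>))) (?I \<gamma>)"
        by (rule hom_finsum [OF R S hom closed]) (fact \<gamma>)+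
      also have "\<dots> = finsum (S \<gamma>) (\<lambda>(\<alpha>, \<beta>). mul' \<alpha> \<beta> (h F \<alpha>) (h H \<beta>)) (?I \<gamma>)"
      proof (rule S\<gamma>.finsum_cong' [OF refl])
        have eq: "mul' \<alpha> \<beta> (h F \<alpha>) (h H \<beta>) = \<phi> \<gamma> (mul \<alpha> \<beta> (F \<alpha>) (H \<beta>))"
          and "mul \<alpha> \<beta> (F \<alpha>) (H \<beta>) \<in> carrier (R \<gamma>)" if "(\<alpha>, \<beta>) \<in> ?I \<gamma>" for \<alpha> \<beta>
          using that mul [of \<alpha> \<beta> "F \<alpha>" "H \<beta>"] mul_closed [of \<alpha> \<beta> "F \<alpha>" "H \<beta>"] comp [OF F] comp [OF H]
          by (auto simp: h_def)
        then show "(\<lambda>(\<alpha>, \<beta>). mul' \<alpha> \<beta> (h F \<alpha>) (h H \<beta>)) \<in> ?I \<gamma> \<rightarrow> carrier (S \<gamma>)"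
          using \<phi>_closed [OF \<gamma>] by (intro funcsetI) (clarsimp simp only: split_paired_all prod.case)
        show "\<phi> \<gamma> (case p of (\<alpha>, \<beta>) \<Rightarrow> mul \<alpha> \<beta> (F \<alpha>) (H \<beta>)) = (case p of (\<alpha>, \<beta>) \<Rightarrow> mul' \<alpha> \<beta> (h F \<alpha>) (h H \<beta>))"
          if "p \<in> ?I \<gamma>" for p
          using that eq by (cases p) (simp only: prod.case)
      qed
      finally show "\<phi> \<gamma> (finsum (R \<gamma>) (\<lambda>(\<alpha>, \<beta>). mul \<alpha> \<beta> (F \<alpha>) (H \<beta>)) (?I \<gamma>)) =
        finsum (S \<gamma>) (\<lambda>(\<alpha>, \<beta>). mul' \<alpha> \<beta> (h F \<alpha>) (h H \<beta>)) (?I \<gamma>)" .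
    qed
    also have "\<dots> = h F \<otimes>\<^bsub>SS\<^esub> h H"
      unfolding SS_def graded_sum_ring_def Let_def
      by (simp only: monoid.simps supp [OF F] supp [OF H])
    finally show "h (F \<otimes>\<^bsub>RR\<^esub> H) = h F \<otimes>\<^bsub>SS\<^esub> h H" .
  next
    show "h \<one>\<^bsub>RR\<^esub> = \<one>\<^bsub>SS\<^esub>"
      using unit \<phi>_zero by (auto simp: h_def RR_def SS_def graded_sum_ring_def Let_def intro!: restrict_ext)
  qed
  moreover have "bij_betw h (carrier RR) (carrier SS)"
    by (rule bij_betw_byWitness [where f' = k]) (use h_closed k_closed hk kh in auto)
  moreover have "h ` homogeneous_part G RR \<alpha> = homogeneous_part G SS \<alpha>" if "\<alpha> \<in> carrier G" for \<alpha>
  proof -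
    have zero: "\<zero>\<^bsub>RR\<^esub> \<beta> = \<zero>\<^bsub>R \<beta>\<^esub>" "\<zero>\<^bsub>SS\<^esub> \<beta> = \<zero>\<^bsub>S \<beta>\<^esub>" if "\<beta> \<in> carrier G" for \<beta>
      using that by (simp_all add: RR_def SS_def graded_sum_ring_def Let_def)
    have iff: "h F \<in> homogeneous_part G SS \<alpha> \<longleftrightarrow> F \<in> homogeneous_part G RR \<alpha>" if "F \<in> carrier RR" for F
      using that comp [OF that] h_closed by (simp add: homogeneous_part_def zero h_def \<phi>_zero_iff)
    show ?thesis
    proof
      show "h ` homogeneous_part G RR \<alpha> \<subseteq> homogeneous_part G SS \<alpha>"
        using iff by (auto simp: homogeneous_part_def [of G RR])
      show "homogeneous_part G SS \<alpha> \<subseteq> h ` homogeneous_part G RR \<alpha>"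
      proof
        fix H assume H: "H \<in> homogeneous_part G SS \<alpha>"
        then have "H \<in> carrier SS" by (simp add: homogeneous_part_def)
        then show "H \<in> h ` homogeneous_part G RR \<alpha>"
          using H iff [OF k_closed] hk by (metis imageI)
      qed
    qed
  qed
  ultimately show ?thesis
    by (simp add: graded_ring_isos_def ring_iso_def h_def)
qed


section \<open>Cofree group corings\<close>

context group_coring
begin

lemma bimodule_pair: "\<lbrakk>\<alpha> \<in> carrier G; \<beta> \<in> carrier G\<rbrakk> \<Longrightarrow> bimodule_pair A (C \<alpha>) (C \<beta>)"
  by (intro bimodule_pair.intro bimodule)

lemma dual_mult_closed:
  assumes \<alpha>: "\<alpha> \<in> carrier G" and \<beta>: "\<beta> \<in> carrier G"
    and f: "f \<in> carrier (left_dual A (C (inv\<^bsub>G\<^esub> \<alpha>)))" and g: "g \<in> carrier (left_dual A (C (inv\<^bsub>G\<^esub> \<beta>)))"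
  shows "dual_mult G A C \<Delta> \<alpha> \<beta> f g \<in> carrier (left_dual A (C (inv\<^bsub>G\<^esub> (\<alpha> \<otimes>\<^bsub>G\<^esub> \<beta>))))"
  unfolding dual_mult_def using \<alpha> \<beta> comult [of "inv\<^bsub>G\<^esub> \<beta>" "inv\<^bsub>G\<^esub> \<alpha>"]
  by (intro convolution_closed [OF bimodule_pair f g bimodule]) (simp_all add: inv_mult_group)

text \<open>
  A cofree structure \<open>\<gamma>\<close> may have a nontrivial component \<open>\<gamma> \<one>\<close>, an automorphism of the bimodule \<open>C \<one>\<close> that is
  compatible with the comultiplication. It is divided out, so that pulling back in degree \<open>\<one>\<close> fixes the counit
  for a trivial reason: \<open>\<gamma> \<alpha> \<circ> (\<gamma> \<one>)\<^sup>-\<^sup>1\<close> is again a cofree structure, because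
  \<open>\<Delta> c = (\<gamma> \<one> \<otimes> \<gamma> \<one>) (\<Delta> ((\<gamma> \<one>)\<^sup>-\<^sup>1 c))\<close>, and its component at \<open>\<one>\<close> is the identity.
\<close>

lemma cofree_normalized:
  assumes "cofree G A C \<Delta>"
  obtains \<delta> where "\<And>\<alpha>. \<alpha> \<in> carrier G \<Longrightarrow> \<delta> \<alpha> \<in> bimodule_isos A (C \<one>\<^bsub>G\<^esub>) (C \<alpha>)"
    and "\<And>c. c \<in> carrier (C \<one>\<^bsub>G\<^esub>) \<Longrightarrow> \<delta> \<one>\<^bsub>G\<^esub> c = c"
    and "\<And>\<alpha> \<beta> c. \<lbrakk>\<alpha> \<in> carrier G; \<beta> \<in> carrier G; c \<in> carrier (C \<one>\<^bsub>G\<^esub>)\<rbrakk> \<Longrightarrow>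
      \<Delta> \<alpha> \<beta> (\<delta> (\<alpha> \<otimes>\<^bsub>G\<^esub> \<beta>) c) = tensor_map A (C \<alpha>) (C \<beta>) (\<delta> \<alpha>) (\<delta> \<beta>) (\<Delta> \<one>\<^bsub>G\<^esub> \<one>\<^bsub>G\<^esub> c)"
proof -
  let ?E = "C \<one>\<^bsub>G\<^esub>"
  have one: "\<one>\<^bsub>G\<^esub> \<in> carrier G" by simp
  obtain \<gamma> where \<gamma>: "\<And>\<alpha>. \<alpha> \<in> carrier G \<Longrightarrow> \<gamma> \<alpha> \<in> bimodule_isos A ?E (C \<alpha>)"
    and \<Delta>\<gamma>: "\<And>\<alpha> \<beta> c. \<lbrakk>\<alpha> \<in> carrier G; \<beta> \<in> carrier G; c \<in> carrier ?E\<rbrakk> \<Longrightarrow>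
      \<Delta> \<alpha> \<beta> (\<gamma> (\<alpha> \<otimes>\<^bsub>G\<^esub> \<beta>) c) = tensor_map A (C \<alpha>) (C \<beta>) (\<gamma> \<alpha>) (\<gamma> \<beta>) (\<Delta> \<one>\<^bsub>G\<^esub> \<one>\<^bsub>G\<^esub> c)"
    using assms unfolding cofree_def by blast
  define \<sigma> where "\<sigma> = inv_into (carrier ?E) (\<gamma> \<one>\<^bsub>G\<^esub>)"
  have \<sigma>: "\<sigma> \<in> bimodule_isos A ?E ?E"
    unfolding \<sigma>_def by (rule bimodule_isos_inv_into [OF bimodule [OF one] \<gamma> [OF one]])
  have bij: "bij_betw (\<gamma> \<one>\<^bsub>G\<^esub>) (carrier ?E) (carrier ?E)"
    using \<gamma> [OF one] by (simp add: bimodule_isos_def)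
  have \<sigma>_closed: "\<sigma> c \<in> carrier ?E" and \<gamma>\<sigma>: "\<gamma> \<one>\<^bsub>G\<^esub> (\<sigma> c) = c" if "c \<in> carrier ?E" for c
    using bij that by (auto simp: \<sigma>_def bij_betw_def inv_into_into f_inv_into_f)
  have \<sigma>\<gamma>: "\<sigma> (\<gamma> \<one>\<^bsub>G\<^esub> c) = c" if "c \<in> carrier ?E" for c
    using bij that by (simp add: \<sigma>_def bij_betw_def)
  define \<delta> where "\<delta> = (\<lambda>\<alpha> c. \<gamma> \<alpha> (\<sigma> c))"
  have \<delta>: "\<delta> \<alpha> \<in> bimodule_isos A ?E (C \<alpha>)" if "\<alpha> \<in> carrier G" for \<alpha>
    unfolding \<delta>_def by (rule bimodule_isos_comp [OF \<sigma> \<gamma> [OF that]])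
  show thesis
  proof (rule that [of \<delta>])
    show "\<delta> \<alpha> \<in> bimodule_isos A ?E (C \<alpha>)" if "\<alpha> \<in> carrier G" for \<alpha> using that by (rule \<delta>)
    show "\<delta> \<one>\<^bsub>G\<^esub> c = c" if "c \<in> carrier ?E" for c using that by (simp add: \<delta>_def \<gamma>\<sigma>)
    fix \<alpha> \<beta> c assume \<alpha>: "\<alpha> \<in> carrier G" and \<beta>: "\<beta> \<in> carrier G" and c: "c \<in> carrier ?E"
    (* a preimage of the comultiplication of c under gamma 1 tensor gamma 1 *)
    define X where "X = \<Delta> \<one>\<^bsub>G\<^esub> \<one>\<^bsub>G\<^esub> (\<sigma> c)"
    have X: "X \<in> carrier (tensor_bimodule A ?E ?E)"
      using bimodule_mapsD(1) [OF comult [OF one one]] \<sigma>_closed [OF c] by (simp add: X_def)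
    have iso_map: "\<theta> \<in> bimodule_maps A M N" if "\<theta> \<in> bimodule_isos A M N" for \<theta> and M N :: "('a, 'c) bimodule"
      using that by (simp add: bimodule_isos_def)
    have "\<Delta> \<one>\<^bsub>G\<^esub> \<one>\<^bsub>G\<^esub> c = \<Delta> \<one>\<^bsub>G\<^esub> \<one>\<^bsub>G\<^esub> (\<gamma> (\<one>\<^bsub>G\<^esub> \<otimes>\<^bsub>G\<^esub> \<one>\<^bsub>G\<^esub>) (\<sigma> c))"
      using c by (simp add: \<gamma>\<sigma>)
    also have "\<dots> = tensor_map A ?E ?E (\<gamma> \<one>\<^bsub>G\<^esub>) (\<gamma> \<one>\<^bsub>G\<^esub>) X"
      unfolding X_def by (rule \<Delta>\<gamma> [OF one one \<sigma>_closed [OF c]])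
    finally have "tensor_map A (C \<alpha>) (C \<beta>) (\<delta> \<alpha>) (\<delta> \<beta>) (\<Delta> \<one>\<^bsub>G\<^esub> \<one>\<^bsub>G\<^esub> c) =
        tensor_map A (C \<alpha>) (C \<beta>) (\<delta> \<alpha>) (\<delta> \<beta>) (tensor_map A ?E ?E (\<gamma> \<one>\<^bsub>G\<^esub>) (\<gamma> \<one>\<^bsub>G\<^esub>) X)"
      by simp
    also have "\<dots> = tensor_map A (C \<alpha>) (C \<beta>) (\<lambda>x. \<delta> \<alpha> (\<gamma> \<one>\<^bsub>G\<^esub> x)) (\<lambda>x. \<delta> \<beta> (\<gamma> \<one>\<^bsub>G\<^esub> x)) X"
      by (intro tensor_map_comp [OF bimodule_pair [OF one one] bimodule_pair [OF one one] bimodule_pair [OF \<alpha> \<beta>]]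
          iso_map \<gamma> \<delta> one \<alpha> \<beta> X)
    also have "\<dots> = tensor_map A (C \<alpha>) (C \<beta>) (\<gamma> \<alpha>) (\<gamma> \<beta>) X"
      by (rule tensor_map_cong [OF bimodule_pair [OF one one] bimodule_pair [OF \<alpha> \<beta>] _ _ _ _ X])
        (simp_all add: iso_map \<gamma> \<alpha> \<beta> \<delta>_def \<sigma>\<gamma>)
    also have "\<dots> = \<Delta> \<alpha> \<beta> (\<delta> (\<alpha> \<otimes>\<^bsub>G\<^esub> \<beta>) c)"
      unfolding X_def \<delta>_def by (rule \<Delta>\<gamma> [OF \<alpha> \<beta> \<sigma>_closed [OF c], symmetric])
    finally show "\<Delta> \<alpha> \<beta> (\<delta> (\<alpha> \<otimes>\<^bsub>G\<^esub> \<beta>) c) = tensor_map A (C \<alpha>) (C \<beta>) (\<delta> \<alpha>) (\<delta> \<beta>) (\<Delta> \<one>\<^bsub>G\<^esub> \<one>\<^bsub>G\<^esub> c)" ..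
  qed
qed

text \<open>
  The product of forms of degrees \<open>\<alpha>\<close> and \<open>\<beta>\<close> evaluates the comultiplication into \<open>C (inv \<beta>) \<otimes> C (inv \<alpha>)\<close>; the reversal is consistent
  because \<open>inv (\<alpha> \<otimes> \<beta>) = inv \<beta> \<otimes> inv \<alpha>\<close>, so the cofree condition applies to the pair
  \<open>(inv \<beta>, inv \<alpha>)\<close> and reduces the product to the one of degree \<open>\<one>\<close>.
\<close>

lemma pullback_dual_mult:
  assumes \<delta>: "\<And>\<alpha>. \<alpha> \<in> carrier G \<Longrightarrow> \<delta> \<alpha> \<in> bimodule_isos A (C \<one>\<^bsub>G\<^esub>) (C \<alpha>)"
    and \<Delta>\<delta>: "\<And>\<alpha> \<beta> c. \<lbrakk>\<alpha> \<in> carrier G; \<beta> \<in> carrier G; c \<in> carrier (C \<one>\<^bsub>G\<^esub>)\<rbrakk> \<Longrightarrow>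
      \<Delta> \<alpha> \<beta> (\<delta> (\<alpha> \<otimes>\<^bsub>G\<^esub> \<beta>) c) = tensor_map A (C \<alpha>) (C \<beta>) (\<delta> \<alpha>) (\<delta> \<beta>) (\<Delta> \<one>\<^bsub>G\<^esub> \<one>\<^bsub>G\<^esub> c)"
    and \<alpha>: "\<alpha> \<in> carrier G" and \<beta>: "\<beta> \<in> carrier G"
    and f: "f \<in> carrier (left_dual A (C (inv\<^bsub>G\<^esub> \<alpha>)))" and g: "g \<in> carrier (left_dual A (C (inv\<^bsub>G\<^esub> \<beta>)))"
  shows "pullback (C \<one>\<^bsub>G\<^esub>) (\<delta> (inv\<^bsub>G\<^esub> (\<alpha> \<otimes>\<^bsub>G\<^esub> \<beta>))) (dual_mult G A C \<Delta> \<alpha> \<beta> f g) =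
    dual_mult G A C \<Delta> \<one>\<^bsub>G\<^esub> \<one>\<^bsub>G\<^esub>
      (pullback (C \<one>\<^bsub>G\<^esub>) (\<delta> (inv\<^bsub>G\<^esub> \<alpha>)) f) (pullback (C \<one>\<^bsub>G\<^esub>) (\<delta> (inv\<^bsub>G\<^esub> \<beta>)) g)"
proof -
  let ?E = "C \<one>\<^bsub>G\<^esub>" and ?\<alpha> = "inv\<^bsub>G\<^esub> \<alpha>" and ?\<beta> = "inv\<^bsub>G\<^esub> \<beta>"
  have one: "\<one>\<^bsub>G\<^esub> \<in> carrier G" and inv: "?\<alpha> \<in> carrier G" "?\<beta> \<in> carrier G"
    using \<alpha> \<beta> by simp_all
  have map: "\<delta> \<alpha> \<in> bimodule_maps A ?E (C \<alpha>)" if "\<alpha> \<in> carrier G" for \<alpha>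
    using \<delta> [OF that] by (simp add: bimodule_isos_def)
  have "tensor_lift A (\<lambda>x y. g (x \<odot>\<^sub>r\<^bsub>C ?\<beta>\<^esub> f y)) (\<Delta> ?\<beta> ?\<alpha> (\<delta> (?\<beta> \<otimes>\<^bsub>G\<^esub> ?\<alpha>) c)) =
      tensor_lift A (\<lambda>x y. pullback ?E (\<delta> ?\<beta>) g (x \<odot>\<^sub>r\<^bsub>?E\<^esub> pullback ?E (\<delta> ?\<alpha>) f y)) (\<Delta> \<one>\<^bsub>G\<^esub> \<one>\<^bsub>G\<^esub> c)"
    if c: "c \<in> carrier ?E" for c
  proof -
    have "\<Delta> \<one>\<^bsub>G\<^esub> \<one>\<^bsub>G\<^esub> c \<in> carrier (tensor_bimodule A ?E ?E)"
      using bimodule_mapsD(1) [OF comult [OF one one]] c by simp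
    then show ?thesis
      unfolding \<Delta>\<delta> [OF inv(2,1) c]
      by (intro convolution_pullback [OF bimodule_pair bimodule_pair map map f g] one inv)
  qed
  moreover have "\<delta> (?\<beta> \<otimes>\<^bsub>G\<^esub> ?\<alpha>) c \<in> carrier (C (?\<beta> \<otimes>\<^bsub>G\<^esub> ?\<alpha>))" if "c \<in> carrier ?E" for c
    using bimodule_mapsD(1) [OF map that] inv by simp
  ultimately show ?thesis
    unfolding pullback_def [of _ _ "dual_mult G A C \<Delta> \<alpha> \<beta> f g"]
    using \<alpha> \<beta> by (auto simp: dual_mult_def inv_mult_group intro!: restrict_ext)
qed

end

theorem proposition4p6:
  fixes G :: "('g, 'h) monoid_scheme"
    and A :: "('a, 'k) ring_scheme"
    and C :: "'g \<Rightarrow> ('a, 'c) bimodule"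
    and \<Delta> :: "'g \<Rightarrow> 'g \<Rightarrow> 'c \<Rightarrow> ('c, 'c) tensor"
    and \<epsilon> :: "'c \<Rightarrow> 'a"
  assumes "group_coring G A C \<Delta> \<epsilon>"
    and "cofree G A C \<Delta>"
  shows "let R = left_dual_graded_ring G A C \<Delta> \<epsilon>;
             S = group_ring G (left_dual_unit_part G A C \<Delta> \<epsilon>)
         in \<exists>h. h \<in> graded_ring_isos G R (homogeneous_part G R) S (homogeneous_part G S)"
proof -
  interpret group_coring G A C \<Delta> \<epsilon> by fact
  let ?E = "C \<one>\<^bsub>G\<^esub>" and ?Re = "left_dual_unit_part G A C \<Delta> \<epsilon>"
  obtain \<delta> where \<delta>: "\<And>\<alpha>. \<alpha> \<in> carrier G \<Longrightarrow> \<delta> \<alpha> \<in> bimodule_isos A ?E (C \<alpha>)"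
    and \<delta>_one: "\<And>c. c \<in> carrier ?E \<Longrightarrow> \<delta> \<one>\<^bsub>G\<^esub> c = c"
    and \<Delta>\<delta>: "\<And>\<alpha> \<beta> c. \<lbrakk>\<alpha> \<in> carrier G; \<beta> \<in> carrier G; c \<in> carrier ?E\<rbrakk> \<Longrightarrow>
      \<Delta> \<alpha> \<beta> (\<delta> (\<alpha> \<otimes>\<^bsub>G\<^esub> \<beta>) c) = tensor_map A (C \<alpha>) (C \<beta>) (\<delta> \<alpha>) (\<delta> \<beta>) (\<Delta> \<one>\<^bsub>G\<^esub> \<one>\<^bsub>G\<^esub> c)"
    using cofree_normalized [OF assms(2)] by metis
  have add_monoid_Re: "add_monoid ?Re = add_monoid (left_dual A ?E)"
    by (simp add: left_dual_unit_part_def)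
  have "comm_group (add_monoid (left_dual A ?E))"
    by (intro abelian_group.a_comm_group abelian_group_left_dual bimodule) simp
  then have Re: "abelian_group ?Re"
    by (intro comm_group_abelian_groupI) (simp only: add_monoid_Re)
  have "(\<lambda>F. \<lambda>\<alpha>\<in>carrier G. pullback ?E (\<delta> (inv\<^bsub>G\<^esub> \<alpha>)) (F \<alpha>)) \<in>
    graded_ring_isos G (left_dual_graded_ring G A C \<Delta> \<epsilon>) (homogeneous_part G (left_dual_graded_ring G A C \<Delta> \<epsilon>))
      (group_ring G ?Re) (homogeneous_part G (group_ring G ?Re))"
    unfolding left_dual_graded_ring_def group_ring_def
  proof (rule graded_sum_ring_isoI)
    show "monoid G" by (rule G.is_monoid)
    show "abelian_group (left_dual A (C (inv\<^bsub>G\<^esub> \<alpha>)))" if "\<alpha> \<in> carrier G" for \<alpha>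
      using that by (intro abelian_group_left_dual bimodule) simp
    show "abelian_group ?Re" by (rule Re)
    show "pullback ?E (\<delta> (inv\<^bsub>G\<^esub> \<alpha>)) \<in> iso (add_monoid (left_dual A (C (inv\<^bsub>G\<^esub> \<alpha>)))) (add_monoid ?Re)"
      if "\<alpha> \<in> carrier G" for \<alpha>
      unfolding add_monoid_Re using that by (intro pullback_iso bimodule \<delta>) simp_all
    show "pullback ?E (\<delta> (inv\<^bsub>G\<^esub> \<one>\<^bsub>G\<^esub>)) (restrict \<epsilon> (carrier ?E)) = \<one>\<^bsub>?Re\<^esub>"
      by (auto simp: pullback_def \<delta>_one left_dual_unit_part_def intro!: restrict_ext)
    show "pullback ?E (\<delta> (inv\<^bsub>G\<^esub> (\<alpha> \<otimes>\<^bsub>G\<^esub> \<beta>))) (dual_mult G A C \<Delta> \<alpha> \<beta> f g) =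
        pullback ?E (\<delta> (inv\<^bsub>G\<^esub> \<alpha>)) f \<otimes>\<^bsub>?Re\<^esub> pullback ?E (\<delta> (inv\<^bsub>G\<^esub> \<beta>)) g"
      if "\<alpha> \<in> carrier G" "\<beta> \<in> carrier G" "f \<in> carrier (left_dual A (C (inv\<^bsub>G\<^esub> \<alpha>)))"
        "g \<in> carrier (left_dual A (C (inv\<^bsub>G\<^esub> \<beta>)))" for \<alpha> \<beta> f g
      using pullback_dual_mult [OF \<delta> \<Delta>\<delta> that] by (simp add: left_dual_unit_part_def)
  qed (rule dual_mult_closed)
  then show ?thesis
    unfolding Let_def by blast
qed

end
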